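(* There exists a graph on sixteen vertices such that constructing a circle packing for the graph on a radical computation tree is not possible.
   Context: A circle packing representing a planar graph $G$ is a collection of circles in the plane with pairwise disjoint interiors, one per vertex, such that the circles of adjacent vertices are tangent; constructing it means computing all centers (as complex numbers) and radii. An algebraic computation tree is a rooted tree whose computation nodes compute a value as the sum, difference, product or quotient of integer constants and values computed at ancestor nodes, and whose decision nodes test whether a computed value is greater than zero and branch. A radical computation tree additionally allows computing the $k$-th root of a previously computed value ($k$ an integer parameter) and complex conjugation. *)

theory Defs
  imports Complex_Main
begin

definition simple_graph :: "nat \<Rightarrow> (nat \<Rightarrow> nat \<Rightarrow> bool) \<Rightarrow> bool" where
  "simple_graph n E \<longleftrightarrow>
     (\<forall>u v. E u v \<longrightarrow> u < n \<and> v < n) \<and>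
     (\<forall>u v. E u v \<longrightarrow> E v u) \<and>
     (\<forall>v. \<not> E v v)"

definition circle_packing ::
  "nat \<Rightarrow> (nat \<Rightarrow> nat \<Rightarrow> bool) \<Rightarrow> (nat \<Rightarrow> complex) \<Rightarrow> (nat \<Rightarrow> real) \<Rightarrow> bool" where
  "circle_packing n E c r \<longleftrightarrow>
     (\<forall>v<n. r v > 0) \<and>
     (\<forall>u<n. \<forall>v<n. u \<noteq> v \<longrightarrow> cmod (c u - c v) \<ge> r u + r v) \<and>
     (\<forall>u<n. \<forall>v<n. E u v \<longrightarrow> cmod (c u - c v) = r u + r v)"

text \<open>Operations of a computation node. Arguments are indices into the list of
  values computed at ancestor nodes (in order, root first).
  RRoot k i computes a k-th root of value i; RConj i its complex conjugate.\<close>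

datatype rop =
    RConst int
  | RAdd nat nat
  | RSub nat nat
  | RMul nat nat
  | RDiv nat nat
  | RRoot nat nat
  | RConj nat

text \<open>A leaf lists the indices of the computed values it outputs; a decision node
  tests whether a computed value is greater than zero (i.e. a positive real).\<close>

datatype rtree =
    RLeaf "nat list"
  | RComp rop rtree
  | RDec nat rtree rtree

definition cpos :: "complex \<Rightarrow> bool" where
  "cpos z \<longleftrightarrow> Im z = 0 \<and> Re z > 0"

inductive rop_step :: "complex list \<Rightarrow> rop \<Rightarrow> complex \<Rightarrow> bool" where
  "rop_step vs (RConst m) (of_int m)"
| "i < length vs \<Longrightarrow> j < length vs \<Longrightarrow> rop_step vs (RAdd i j) (vs!i + vs!j)"
| "i < length vs \<Longrightarrow> j < length vs \<Longrightarrow> rop_step vs (RSub i j) (vs!i - vs!j)"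
| "i < length vs \<Longrightarrow> j < length vs \<Longrightarrow> rop_step vs (RMul i j) (vs!i * vs!j)"
| "i < length vs \<Longrightarrow> j < length vs \<Longrightarrow> vs!j \<noteq> 0 \<Longrightarrow> rop_step vs (RDiv i j) (vs!i / vs!j)"
| "i < length vs \<Longrightarrow> k \<ge> 1 \<Longrightarrow> y ^ k = vs!i \<Longrightarrow> rop_step vs (RRoot k i) y"
| "i < length vs \<Longrightarrow> rop_step vs (RConj i) (cnj (vs!i))"

inductive rtree_run :: "rtree \<Rightarrow> complex list \<Rightarrow> complex list \<Rightarrow> bool" where
  leaf: "(\<forall>i\<in>set is. i < length vs) \<Longrightarrow> rtree_run (RLeaf is) vs (map (\<lambda>i. vs!i) is)"
| comp: "rop_step vs p x \<Longrightarrow> rtree_run t (vs @ [x]) out \<Longrightarrow> rtree_run (RComp p t) vs out"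
| dec_yes: "i < length vs \<Longrightarrow> cpos (vs!i) \<Longrightarrow> rtree_run t1 vs out \<Longrightarrow> rtree_run (RDec i t1 t2) vs out"
| dec_no: "i < length vs \<Longrightarrow> \<not> cpos (vs!i) \<Longrightarrow> rtree_run t2 vs out \<Longrightarrow> rtree_run (RDec i t1 t2) vs out"

definition constructs_packing :: "nat \<Rightarrow> (nat \<Rightarrow> nat \<Rightarrow> bool) \<Rightarrow> rtree \<Rightarrow> bool" where
  "constructs_packing n E t \<longleftrightarrow>
     (\<exists>out. rtree_run t [] out \<and> length out = 2 * n \<and>
        (\<forall>v<n. Im (out ! (n + v)) = 0) \<and>
        circle_packing n E (\<lambda>v. out ! v) (\<lambda>v. Re (out ! (n + v))))"

end

theory Submission
  imports Defs "HOL-Number_Theory.Residue_Primitive_Roots"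
    "HOL-Computational_Algebra.Fundamental_Theorem_Algebra"
    "HOL-Computational_Algebra.Polynomial_Factorial"
begin

text \<open>For two circles with centres \<open>c\<close>, \<open>c'\<close> and radii \<open>r\<close>, \<open>r'\<close> put
  \<open>\<lambda> = sqrt ((|c - c'|\<^sup>2 - (r - r')\<^sup>2) / (4 r r'))\<close> (\<open>half_chord\<close>). Disjointness says \<open>\<lambda> \<ge> 1\<close>, tangency says \<open>\<lambda> = 1\<close>, and
  by Casey's theorem the numbers \<open>\<lambda>\<close> of four circles tangent to a fifth satisfy Ptolemy's relation.
  In the graph \<open>gadget\<close> these relations force \<open>x = \<lambda>(0, 2)\<close> to satisfy
  \<open>x\<^sup>5 - 5 x\<^sup>3 + 7 x - 2 = 0\<close> in every packing. This quintic is irreducible over the rationals and has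
  both several real and some nonreal roots, so by a theorem of Kronecker none of its roots is
  expressible by radicals. The vertices 10 to 15 are isolated.\<close>

section \<open>Polynomials over subfields of the complex numbers\<close>

text \<open>A tree may output any packing, and Moebius maps move packings around, so centres and
  radii themselves satisfy no fixed equation; \<open>half_chord\<close> is Moebius invariant. The
  subgraph on vertices 0 to 9 is a maximal planar graph (24 = 3 * 10 - 6 edges), whose packing is
  rigid up to such maps. Casey's theorem is used without knowing the cyclic order of the tangency
  points, so each relation has three possible signs. Only the bounds \<lambda> \<ge> 1 decide
  between them. For Kronecker's theorem the obstacle is to let complex conjugation act on a radical
  tower. Each radical a is adjoined in two steps, first the real number a * cnj a, then a. If f
  first became reducible at such a step, its roots would be indexed by the residues modulo p and
  conjugation would act on the indices as a reflection or a translation. Neither fits two real roots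
  together with a nonreal one. With x = 2 cos h the quintic says cos (5 h) = 1 - x, the condition
  that a chain of six circles around two poles closes up with the caps. A packing is constructed
  because the impossibility claim would otherwise be vacuous.\<close>

locale complex_subfield =
  fixes K :: "complex set"
  assumes one: "1 \<in> K"
    and diff: "x \<in> K \<Longrightarrow> y \<in> K \<Longrightarrow> x - y \<in> K"
    and mult: "x \<in> K \<Longrightarrow> y \<in> K \<Longrightarrow> x * y \<in> K"
    and inverse: "x \<in> K \<Longrightarrow> inverse x \<in> K"
begin

lemma zero: "0 \<in> K"
  using diff[OF one one] by simp

lemma minus: "x \<in> K \<Longrightarrow> - x \<in> K"
  using diff[OF zero] by fastforce

lemma add: "x \<in> K \<Longrightarrow> y \<in> K \<Longrightarrow> x + y \<in> K"
  using diff[OF _ minus] by fastforce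

lemma divide: "x \<in> K \<Longrightarrow> y \<in> K \<Longrightarrow> x / y \<in> K"
  using mult[OF _ inverse] by (simp add: divide_inverse)

lemma of_nat: "of_nat n \<in> K"
  by (induction n) (auto intro: zero one add)

lemma of_int: "of_int n \<in> K"
  by (cases n) (auto intro: of_nat minus simp del: of_nat_Suc)

lemma power: "x \<in> K \<Longrightarrow> x ^ n \<in> K"
  by (induction n) (auto intro: one mult)

lemma sum: "(\<And>i. i \<in> A \<Longrightarrow> f i \<in> K) \<Longrightarrow> sum f A \<in> K"
  by (induction A rule: infinite_finite_induct) (auto intro: zero add)

lemma prod: "(\<And>i. i \<in> A \<Longrightarrow> f i \<in> K) \<Longrightarrow> prod f A \<in> K"
  by (induction A rule: infinite_finite_induct) (auto intro: one mult)

end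

text \<open>A set of complex polynomials rather than a type per field, so that the base field can
  grow while the polynomials and their roots stay put.\<close>

definition polys_over :: "complex set \<Rightarrow> complex poly set" where
  "polys_over K = {P. \<forall>i. coeff P i \<in> K}"

lemma polys_over_mono: "K \<subseteq> L \<Longrightarrow> polys_over K \<subseteq> polys_over L"
  unfolding polys_over_def by auto

context complex_subfield
begin

lemma polys_zero: "0 \<in> polys_over K"
  by (auto simp: polys_over_def zero)

lemma polys_add: "P \<in> polys_over K \<Longrightarrow> Q \<in> polys_over K \<Longrightarrow> P + Q \<in> polys_over K"
  by (auto simp: polys_over_def intro: add)

lemma polys_diff: "P \<in> polys_over K \<Longrightarrow> Q \<in> polys_over K \<Longrightarrow> P - Q \<in> polys_over K"
  by (auto simp: polys_over_def intro: diff)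

lemma polys_mult: "P \<in> polys_over K \<Longrightarrow> Q \<in> polys_over K \<Longrightarrow> P * Q \<in> polys_over K"
  by (auto simp: polys_over_def coeff_mult intro!: sum mult)

lemma polys_monom: "c \<in> K \<Longrightarrow> monom c n \<in> polys_over K"
  by (auto simp: polys_over_def intro: zero)

lemma polys_const: "c \<in> K \<Longrightarrow> [:c:] \<in> polys_over K"
  using polys_monom[of c 0] by (simp add: monom_0)

lemma polys_smult: "c \<in> K \<Longrightarrow> P \<in> polys_over K \<Longrightarrow> smult c P \<in> polys_over K"
  by (auto simp: polys_over_def intro: mult)

lemma polys_sum: "(\<And>i. i \<in> A \<Longrightarrow> f i \<in> polys_over K) \<Longrightarrow> sum f A \<in> polys_over K"
  by (induction A rule: infinite_finite_induct) (auto intro: polys_zero polys_add)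

lemma polys_prod: "(\<And>i. i \<in> A \<Longrightarrow> f i \<in> polys_over K) \<Longrightarrow> prod f A \<in> polys_over K"
  by (induction A rule: infinite_finite_induct)
     (auto intro: polys_mult polys_const[OF one, folded one_pCons])

lemma polys_power: "P \<in> polys_over K \<Longrightarrow> P ^ n \<in> polys_over K"
  using polys_prod[of "{..<n}" "\<lambda>_. P"] by simp

lemma polys_pcompose: "P \<in> polys_over K \<Longrightarrow> Q \<in> polys_over K \<Longrightarrow> P \<circ>\<^sub>p Q \<in> polys_over K"
  unfolding polys_over_def mem_Collect_eq
  by (rule allI, rule coeff_pcompose_semiring_closed) (auto intro: zero add mult)

lemma polys_pderiv: "P \<in> polys_over K \<Longrightarrow> pderiv P \<in> polys_over K"
  by (auto simp: polys_over_def coeff_pderiv intro!: mult of_nat simp del: of_nat_Suc)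

lemma poly_in: "P \<in> polys_over K \<Longrightarrow> x \<in> K \<Longrightarrow> poly P x \<in> K"
  by (auto simp: polys_over_def poly_altdef intro!: sum mult power)

text \<open>Long division: subtracting \<open>M * Q\<close> cancels the leading term, and the only
  coefficient division is by \<open>lead_coeff Q\<close>, so nothing leaves K.\<close>

lemma polys_divmod:
  assumes "Q \<in> polys_over K" "Q \<noteq> 0" "P \<in> polys_over K"
  obtains A R where "A \<in> polys_over K" "R \<in> polys_over K" "P = A * Q + R" "R = 0 \<or> degree R < degree Q"
proof -
  have "\<exists>A R. A \<in> polys_over K \<and> R \<in> polys_over K \<and> P = A * Q + R \<and> (R = 0 \<or> degree R < degree Q)"
    using assms(3)
  proof (induction "degree P" arbitrary: P rule: less_induct)
    case less
    show ?case
    proof (cases "P = 0 \<or> degree P < degree Q")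
      case True
      then show ?thesis using less.prems polys_zero by (intro exI[of _ 0] exI[of _ P]) auto
    next
      case False
      define M where "M = monom (lead_coeff P / lead_coeff Q) (degree P - degree Q)"
      have M: "M \<in> polys_over K"
        using less.prems assms(1) by (auto simp: M_def polys_over_def intro!: divide zero)
      define P' where "P' = P - M * Q"
      have P': "P' \<in> polys_over K"
        using less.prems M assms(1) by (auto simp: P'_def intro: polys_diff polys_mult)
      have lcM: "lead_coeff P / lead_coeff Q \<noteq> 0" using False assms(2) by auto
      then have M0: "M \<noteq> 0" and dM: "degree M = degree P - degree Q" and lM: "lead_coeff M = lead_coeff P / lead_coeff Q"
        by (auto simp: M_def degree_monom_eq)
      have dMQ: "degree (M * Q) = degree P"
        using False dM M0 assms(2) by (auto simp: degree_mult_eq)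
      have "lead_coeff (M * Q) = lead_coeff P"
        using assms(2) by (simp add: lead_coeff_mult lM)
      then have c0: "coeff P' (degree P) = 0" by (simp add: P'_def dMQ)
      have le: "degree P' \<le> degree P" unfolding P'_def by (rule degree_diff_le) (auto simp: dMQ)
      show ?thesis
      proof (cases "P' = 0")
        case True
        then have "P = M * Q + 0" by (simp add: P'_def)
        then show ?thesis using M polys_zero by blast
      next
        case F2: False
        have "degree P' < degree P"
          using le c0 F2 by (metis leading_coeff_0_iff le_neq_implies_less)
        from less.hyps[OF this P'] obtain A R where AR: "A \<in> polys_over K" "R \<in> polys_over K"
          "P' = A * Q + R" "R = 0 \<or> degree R < degree Q" by blast
        have "P = (M + A) * Q + R" using AR(3) by (simp add: P'_def algebra_simps)
        then show ?thesis using AR M polys_add by blast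
      qed
    qed
  qed
  then show ?thesis using that by blast
qed

lemma minimal_poly_dvd:
  assumes "h \<in> polys_over K" "h \<noteq> 0" "poly h z = 0"
    and min: "\<And>Q. Q \<in> polys_over K \<Longrightarrow> Q \<noteq> 0 \<Longrightarrow> poly Q z = 0 \<Longrightarrow> degree h \<le> degree Q"
    and P: "P \<in> polys_over K" "poly P z = 0"
  obtains A where "A \<in> polys_over K" "P = A * h"
proof -
  obtain A R where AR: "A \<in> polys_over K" "R \<in> polys_over K" "P = A * h + R" "R = 0 \<or> degree R < degree h"
    using polys_divmod[OF assms(1,2) P(1)] .
  have "poly R z = 0" using AR(3) P(2) assms(3) by simp
  then have "R = 0" using min[OF AR(2)] AR(4) by (cases "R = 0") auto
  then show ?thesis using that AR by simp
qed

end

text \<open>For \<open>f\<close> with coefficients in \<open>K\<close> this is irreducibility over \<open>K\<close>, stated so that it can be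
  applied without factoring: every root of \<open>f\<close> has degree at least \<open>degree f\<close> over \<open>K\<close>.\<close>

definition roots_full_degree :: "complex set \<Rightarrow> complex poly \<Rightarrow> bool" where
  "roots_full_degree K f \<longleftrightarrow>
     (\<forall>P z. P \<in> polys_over K \<longrightarrow> P \<noteq> 0 \<longrightarrow> poly f z = 0 \<longrightarrow> poly P z = 0 \<longrightarrow> degree f \<le> degree P)"

context complex_subfield
begin

text \<open>A multiple root would be a root of \<open>pderiv f\<close>, which is nonzero, lies over
  K and has smaller degree.\<close>

lemma rsquarefree_if_full_degree:
  assumes "f \<in> polys_over K" "degree f > 1" "roots_full_degree K f"
  shows "rsquarefree f"
  unfolding rsquarefree_roots
proof (intro allI notI)
  fix a assume a: "poly f a = 0 \<and> poly (pderiv f) a = 0"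
  have "pderiv f \<noteq> 0" using assms(2) by (simp add: pderiv_eq_0_iff)
  then show False
    using assms a polys_pderiv[OF assms(1)] degree_pderiv[of f] unfolding roots_full_degree_def by fastforce
qed

end

lemma card_roots_rsquarefree:
  assumes "rsquarefree (p :: complex poly)"
  shows "card {z. poly p z = 0} = degree p"
proof -
  have p0: "p \<noteq> 0" using assms by (auto simp: rsquarefree_def)
  have fin: "finite {z. poly p z = 0}" using p0 by (rule poly_roots_finite)
  have "degree p = degree (\<Prod>z|poly p z = 0. [:-z, 1:])"
    using complex_poly_decompose_rsquarefree[OF assms] p0
    by (metis degree_smult_eq leading_coeff_0_iff)
  also have "\<dots> = card {z. poly p z = 0}"
    using fin by (subst degree_prod_eq_sum_degree) auto
  finally show ?thesis by simp
qed

lemma rsquarefree_dvd: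
  assumes "rsquarefree (p :: complex poly)" "q dvd p"
  shows "rsquarefree q"
  unfolding rsquarefree_roots
proof (intro allI notI)
  fix a assume a: "poly q a = 0 \<and> poly (pderiv q) a = 0"
  obtain r where "p = q * r" using assms(2) by (elim dvdE)
  then have "poly p a = 0" "poly (pderiv p) a = 0"
    using a by (auto simp: pderiv_mult)
  then show False using assms(1) unfolding rsquarefree_roots by blast
qed

section \<open>Adjoining a root of prime degree\<close>

locale prime_root_of_unity =
  fixes p :: nat and \<zeta> :: complex
  assumes p: "prime p" and zeta_p: "\<zeta> ^ p = 1" and zeta_ne: "\<zeta> \<noteq> 1"
begin

lemma p_pos: "p > 0"
  using p by (simp add: prime_gt_0_nat)

lemma zeta_0: "\<zeta> \<noteq> 0"
  using zeta_p p_pos by (auto simp: power_0_left)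

lemma zeta_dvd: "p dvd i \<Longrightarrow> \<zeta> ^ i = 1"
  by (auto simp: power_mult zeta_p)

lemma zeta_pow_1_iff: "\<zeta> ^ i = 1 \<longleftrightarrow> p dvd i"
proof
  assume i: "\<zeta> ^ i = 1"
  show "p dvd i"
  proof (rule ccontr)
    assume "\<not> p dvd i"
    then have "coprime i p" using p by (meson coprime_commute prime_imp_coprime)
    then obtain a b where "i * a = p * b + 1"
      using bezout_nat[of i p] p p_pos
      by (metis \<open>\<not> p dvd i\<close> coprime_imp_gcd_eq_1 dvd_0_right)
    then have "\<zeta> ^ (i * a) = \<zeta> ^ (p * b + 1)" by simp
    then show False using i zeta_p zeta_ne by (simp add: power_mult power_add)
  qed
qed (rule zeta_dvd)

lemma zeta_pow_eq_iff: "\<zeta> ^ i = \<zeta> ^ j \<longleftrightarrow> [i = j] (mod p)"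
proof -
  have *: "\<zeta> ^ i = \<zeta> ^ j \<longleftrightarrow> [i = j] (mod p)" if "i \<le> j" for i j
  proof -
    have "\<zeta> ^ j = \<zeta> ^ i * \<zeta> ^ (j - i)" using that by (simp flip: power_add)
    then have "\<zeta> ^ i = \<zeta> ^ j \<longleftrightarrow> \<zeta> ^ (j - i) = 1" using zeta_0 by auto
    then show ?thesis using zeta_pow_1_iff that
      by (simp add: cong_altdef_nat cong_sym_eq[of i j])
  qed
  show ?thesis
    using *[of i j] *[of j i] by (metis cong_sym_eq nat_le_linear)
qed

lemma zeta_mod: "\<zeta> ^ (i mod p) = \<zeta> ^ i"
  by (simp add: zeta_pow_eq_iff)

text \<open>Averaging over the p-th roots of unity keeps exactly the exponents divisible by p. Every
  proof that a conjugation-invariant quantity lies in K rests on this.\<close>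

lemma sum_zeta_pow: "(\<Sum>k<p. (\<zeta> ^ k) ^ i) = (if p dvd i then of_nat p else 0)"
proof -
  have eq: "(\<zeta> ^ k) ^ i = (\<zeta> ^ i) ^ k" for k by (simp flip: power_mult add: mult.commute)
  show ?thesis
  proof (cases "p dvd i")
    case True
    then show ?thesis unfolding eq by (simp add: zeta_dvd)
  next
    case False
    then have "\<zeta> ^ i \<noteq> 1" by (simp add: zeta_pow_1_iff)
    moreover have "(\<zeta> ^ i) ^ p = 1" by (simp add: zeta_dvd flip: power_mult)
    ultimately show ?thesis unfolding eq using False by (simp add: sum_gp_strict)
  qed
qed

lemma root_of_unity_powerE:
  assumes "z ^ p = 1"
  obtains k where "k < p" "z = \<zeta> ^ k"
proof -
  have inj: "inj_on (\<lambda>k. \<zeta> ^ k) {..<p}"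
    by (auto simp: inj_on_def zeta_pow_eq_iff cong_def)
  have fin: "finite {z :: complex. z ^ p = 1}" "card {z :: complex. z ^ p = 1} = p"
    using p_pos card_roots_unity_eq[of p] finite_roots_unity[of p] by auto
  have sub: "(\<lambda>k. \<zeta> ^ k) ` {..<p} \<subseteq> {z. z ^ p = 1}"
    by (auto simp: zeta_p mult.commute[of _ p] simp flip: power_mult) (simp add: power_mult zeta_p)
  have "(\<lambda>k. \<zeta> ^ k) ` {..<p} = {z. z ^ p = 1}"
    by (rule card_subset_eq) (use fin sub inj in \<open>auto simp: card_image\<close>)
  then have "z \<in> (\<lambda>k. \<zeta> ^ k) ` {..<p}" using assms by blast
  then show ?thesis using that by auto
qed

lemma prod_shift:
  assumes "\<And>k. g (k + p) = g k"
  shows "(\<Prod>k<p. g (k + j)) = (\<Prod>k<p. g (k :: nat) :: 'b :: comm_monoid_mult)"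
proof (induction j)
  case (Suc j)
  have "(\<Prod>k<p. g (k + Suc j)) = (\<Prod>k\<in>{Suc 0..<Suc p}. g (k + j))"
    using prod.atLeast_Suc_lessThan_Suc_shift[of "\<lambda>k. g (k + j)" 0 p] by (simp add: atLeast0LessThan)
  also have "\<dots> = (\<Prod>k\<in>{Suc 0..<p}. g (k + j)) * g (p + j)"
    using p_pos by (subst prod.atLeastLessThan_Suc) (auto simp: Suc_le_eq)
  also have "g (p + j) = g (0 + j)" using assms[of j] by (simp add: add.commute)
  also have "(\<Prod>k\<in>{Suc 0..<p}. g (k + j)) * g (0 + j) = (\<Prod>k<p. g (k + j))"
    using p_pos by (simp add: prod.atLeast_Suc_lessThan mult.commute flip: atLeast0LessThan)
  finally show ?case using Suc by simp
qed simp

end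

locale subfield_with_root_of_unity = complex_subfield K + prime_root_of_unity p \<zeta>
  for K :: "complex set" and p :: nat and \<zeta> :: complex +
  assumes zeta_in: "\<zeta> \<in> K"

context complex_subfield
begin

text \<open>The trace: only powers of s with exponent divisible by p survive, and these are powers
  of \<open>s ^ p\<close>. The root of unity may lie outside K, as it does in
  \<open>prime_unity_root\<close>.\<close>

lemma sum_conjugates_in:
  assumes "prime_root_of_unity p \<zeta>" "s ^ p \<in> K" "P \<in> polys_over K"
  shows "(\<Sum>k<p. poly P (\<zeta> ^ k * s)) \<in> K"
proof -
  interpret prime_root_of_unity p \<zeta> by fact
  have "(\<Sum>k<p. poly P (\<zeta> ^ k * s)) = (\<Sum>k<p. \<Sum>i\<le>degree P. coeff P i * s ^ i * (\<zeta> ^ k) ^ i)"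
    by (simp add: poly_altdef power_mult_distrib mult_ac)
  also have "\<dots> = (\<Sum>i\<le>degree P. coeff P i * s ^ i * (\<Sum>k<p. (\<zeta> ^ k) ^ i))"
    by (subst sum.swap) (simp add: sum_distrib_left)
  also have "\<dots> = (\<Sum>i\<le>degree P. coeff P i * (if p dvd i then s ^ i * of_nat p else 0))"
    by (intro sum.cong) (auto simp: sum_zeta_pow)
  also have "\<dots> \<in> K"
  proof (rule sum, rule mult)
    fix i
    show "coeff P i \<in> K" using assms(3) by (simp add: polys_over_def)
    show "(if p dvd i then s ^ i * of_nat p else 0) \<in> K"
      using power[OF assms(2)] by (auto intro!: mult[OF _ of_nat] zero elim!: dvdE simp: power_mult)
  qed
  finally show ?thesis .
qed

end

context subfield_with_root_of_unity
begin

lemma polys_scale: "P \<in> polys_over K \<Longrightarrow> P \<circ>\<^sub>p [:0, \<zeta> ^ j:] \<in> polys_over K"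
  using polys_monom[of "\<zeta> ^ j" 1] zeta_in
  by (intro polys_pcompose) (auto simp: monom_altdef power)

text \<open>Vieta: the constant coefficient is the product of the negated roots, split off one at a
  time.\<close>

lemma monic_const_coeff:
  assumes "lead_coeff Q = 1" "\<And>w. poly Q w = 0 \<Longrightarrow> \<exists>k. w = \<zeta> ^ k * s"
  shows "\<exists>j. poly Q 0 = (- 1) ^ degree Q * \<zeta> ^ j * s ^ degree Q"
  using assms
proof (induction "degree Q" arbitrary: Q)
  case 0
  then have "Q = 1" by (metis degree_0_id of_nat_1 one_pCons)
  then show ?case by (auto intro!: exI[of _ 0])
next
  case (Suc d)
  then have "\<not> constant (poly Q)" by (simp add: constant_degree)
  then obtain w where w: "poly Q w = 0" using fundamental_theorem_of_algebra by blast
  then obtain R where R: "Q = [:- w, 1:] * R" by (metis dvdE poly_eq_0_iff_dvd)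
  have R0: "R \<noteq> 0" using R Suc.hyps(2) by auto
  have dR: "degree Q = Suc (degree R)" using R0 unfolding R by (subst degree_mult_eq) auto
  have lR: "lead_coeff R = 1" using Suc.prems(1) unfolding R lead_coeff_mult by simp
  obtain j where j: "poly R 0 = (- 1) ^ degree R * \<zeta> ^ j * s ^ degree R"
    using Suc.hyps(1)[of R] Suc.hyps(2) dR lR Suc.prems(2) R by auto
  obtain k where k: "w = \<zeta> ^ k * s" using Suc.prems(2) w by blast
  have "poly Q 0 = - w * poly R 0" by (simp add: R)
  also have "\<dots> = (- 1) ^ degree Q * \<zeta> ^ (k + j) * s ^ degree Q"
    by (simp add: j k dR power_add)
  finally show ?case by blast
qed

end

locale radical_step = subfield_with_root_of_unity +
  fixes s :: complex
  assumes s_p: "s ^ p \<in> K" and s_notin: "s \<notin> K"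
begin

lemma s_0: "s \<noteq> 0"
  using s_notin zero by auto

lemma conj_radical_step: "radical_step K p \<zeta> (\<zeta> ^ i * s)"
proof unfold_locales
  have "(\<zeta> ^ i) ^ p = 1" by (simp add: zeta_dvd flip: power_mult)
  then show "(\<zeta> ^ i * s) ^ p \<in> K"
    by (simp add: power_mult_distrib s_p)
  show "\<zeta> ^ i * s \<notin> K"
  proof
    assume "\<zeta> ^ i * s \<in> K"
    then have "\<zeta> ^ i * s / \<zeta> ^ i \<in> K" by (intro divide power zeta_in)
    then show False using s_notin zeta_0 by simp
  qed
qed

text \<open>The minimal polynomial h of s divides X^p - s^p, so its constant coefficient is a unit
  of K times \<open>s ^ e\<close> with e its degree. If 0 < e < p, then e and p are coprime and
  Bezout writes s in terms of \<open>s ^ e\<close> and \<open>s ^ p\<close>, both in K.\<close>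

lemma degree_ge_if_root:
  assumes "P \<in> polys_over K" "P \<noteq> 0" "poly P s = 0"
  shows "degree P \<ge> p"
proof (rule ccontr)
  assume "\<not> degree P \<ge> p"
  define S where "S = {P. P \<in> polys_over K \<and> P \<noteq> 0 \<and> poly P s = 0}"
  have "P \<in> S" using assms by (simp add: S_def)
  then obtain m where m: "m \<in> S" "\<And>Q. Q \<in> S \<Longrightarrow> degree m \<le> degree Q"
    using ex_has_least_nat[of "\<lambda>P. P \<in> S" P degree] by blast
  have dm: "degree m < p" using m(2)[OF \<open>P \<in> S\<close>] \<open>\<not> degree P \<ge> p\<close> by simp
  have lc: "lead_coeff m \<noteq> 0" "inverse (lead_coeff m) \<in> K"
    using m(1) by (auto simp: S_def polys_over_def intro: inverse)
  define h where "h = smult (inverse (lead_coeff m)) m"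
  have hS: "h \<in> polys_over K" "h \<noteq> 0" "poly h s = 0" and dh: "degree h = degree m" and lh: "lead_coeff h = 1"
    using m(1) lc by (auto simp: h_def S_def intro: polys_smult)
  define B where "B = monom 1 p - [:s ^ p:]"
  have B: "B \<in> polys_over K" "poly B s = 0"
    using s_p by (auto simp: B_def poly_monom intro!: polys_diff polys_monom polys_const one)
  obtain A where A: "B = A * h"
    using minimal_poly_dvd[OF hS _ B] m(2) by (auto simp: dh S_def)
  have "\<exists>k. w = \<zeta> ^ k * s" if "poly h w = 0" for w
  proof -
    have "poly B w = 0" using that A by simp
    then have "(w / s) ^ p = 1" using s_0 by (simp add: B_def poly_monom power_divide)
    then obtain k where "w / s = \<zeta> ^ k" by (elim root_of_unity_powerE)
    then show ?thesis using s_0 by (auto simp: field_simps)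
  qed
  then obtain j where j: "poly h 0 = (- 1) ^ degree h * \<zeta> ^ j * s ^ degree h"
    using monic_const_coeff[OF lh] by blast
  define e where "e = degree h"
  have "s ^ e = poly h 0 / ((- 1) ^ e * \<zeta> ^ j)" using zeta_0 by (simp add: j e_def)
  also have "\<dots> \<in> K"
    by (intro divide mult power minus one zeta_in poly_in hS zero)
  finally have se: "s ^ e \<in> K" .
  have "e \<noteq> 0"
  proof
    assume "e = 0"
    then have "h = 1" using lh unfolding e_def by (metis degree_0_id of_nat_1 one_pCons)
    then show False using hS by simp
  qed
  moreover have "e < p" using dm dh e_def by simp
  ultimately have "\<not> p dvd e" by (simp add: nat_dvd_not_less)
  then have "coprime e p" using p by (meson coprime_commute prime_imp_coprime)
  then obtain a b where ab: "e * a = p * b + 1"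
    using bezout_nat[of e p] \<open>e \<noteq> 0\<close> by (metis coprime_imp_gcd_eq_1)
  have "s = (s ^ e) ^ a / (s ^ p) ^ b"
    using s_0 ab by (simp flip: power_mult)
  also have "\<dots> \<in> K" by (intro divide power se s_p)
  finally show False using s_notin by simp
qed

text \<open>By \<open>degree_ge_if_root\<close>, X^p - s^p is a minimal polynomial of s, hence
  divides P, and it vanishes at all conjugates of s.\<close>

lemma root_conjugate:
  assumes "P \<in> polys_over K" "poly P s = 0"
  shows "poly P (\<zeta> ^ j * s) = 0"
proof -
  define B where "B = monom 1 p - [:s ^ p:]"
  have B: "B \<in> polys_over K" "poly B s = 0"
    using s_p by (auto simp: B_def poly_monom intro!: polys_diff polys_monom polys_const one)
  have dB: "degree B = p"
    unfolding B_def using p_pos by (subst diff_conv_add_uminus, subst degree_add_eq_left) (auto simp: degree_monom_eq)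
  then have B0: "B \<noteq> 0" using p_pos by auto
  obtain A where A: "P = A * B"
    using minimal_poly_dvd[OF B(1) B0 B(2) _ assms] degree_ge_if_root dB by metis
  have "(\<zeta> ^ j) ^ p = 1" by (simp add: zeta_dvd flip: power_mult)
  then have "poly B (\<zeta> ^ j * s) = 0" by (simp add: B_def poly_monom power_mult_distrib)
  then show ?thesis by (simp add: A)
qed

lemma root_conjugate':
  assumes "P \<in> polys_over K" "poly P (\<zeta> ^ i * s) = 0"
  shows "poly P (\<zeta> ^ j * s) = 0"
proof -
  \<comment> \<open>The exponent stands for j - i; reducing i modulo p first keeps the natural
    subtraction from truncating.\<close>
  have "poly P (\<zeta> ^ (p - i mod p + j) * (\<zeta> ^ i * s)) = 0"
    by (rule radical_step.root_conjugate[OF conj_radical_step assms])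
  also have "\<zeta> ^ (p - i mod p + j) * (\<zeta> ^ i * s) = \<zeta> ^ (p - i mod p + i mod p) * \<zeta> ^ j * s"
    unfolding power_add zeta_mod by simp
  also have "p - i mod p + i mod p = p"
    using p_pos by (simp add: less_imp_le)
  finally show ?thesis by (simp add: zeta_p)
qed

text \<open>So \<open>poly P s\<close> \<mapsto> \<open>poly P (\<zeta> ^ j * s)\<close> is well
  defined on K(s). This replaces the automorphisms of K(s) over K.\<close>

lemma conjugates_eq:
  assumes "P \<in> polys_over K" "Q \<in> polys_over K" "poly P s = poly Q s"
  shows "poly P (\<zeta> ^ j * s) = poly Q (\<zeta> ^ j * s)"
  using root_conjugate[of "P - Q"] assms by (simp add: polys_diff)

text \<open>K[s], which \<open>adj_subfield\<close> shows to be all of K(s).\<close>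

definition adj :: "complex set" where
  "adj = (\<lambda>P. poly P s) ` polys_over K"

lemma adjI: "P \<in> polys_over K \<Longrightarrow> poly P s \<in> adj"
  by (auto simp: adj_def)

lemma K_subset_adj: "K \<subseteq> adj"
  using adjI[OF polys_const] by fastforce

lemma s_in_adj: "s \<in> adj"
  using adjI[OF polys_monom[OF one, of 1]] by (simp add: poly_monom)

lemma conj_in_adj: "P \<in> polys_over K \<Longrightarrow> poly P (\<zeta> ^ j * s) \<in> adj"
  using adjI[OF polys_scale[of P j]] by (simp add: poly_pcompose mult.commute)

text \<open>Inverses come from the norm: the product of all conjugates of x is nonzero and equals
  its own average over the conjugates, so it lies in K. The factors other than x then give the
  inverse.\<close>

lemma adj_subfield: "complex_subfield adj"
proof
  show "1 \<in> adj" using K_subset_adj one by blast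
  show "x - y \<in> adj" if "x \<in> adj" "y \<in> adj" for x y
    using that by (auto simp: adj_def simp flip: poly_diff intro: polys_diff)
  show mult: "x * y \<in> adj" if "x \<in> adj" "y \<in> adj" for x y
    using that by (auto simp: adj_def simp flip: poly_mult intro: polys_mult)
  show "inverse x \<in> adj" if "x \<in> adj" for x
  proof (cases "x = 0")
    case True
    then show ?thesis using that by simp
  next
    case False
    obtain P where P: "P \<in> polys_over K" "x = poly P s" using \<open>x \<in> adj\<close> by (auto simp: adj_def)
    define N where "N = (\<Prod>k<p. P \<circ>\<^sub>p [:0, \<zeta> ^ k:])"
    have N: "N \<in> polys_over K" by (auto simp: N_def intro: polys_prod polys_scale P)
    have pN: "poly N t = (\<Prod>k<p. poly P (\<zeta> ^ k * t))" for t
      by (simp add: N_def poly_prod poly_pcompose mult.commute)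
    have inv: "poly N (\<zeta> ^ j * s) = poly N s" for j
    proof -
      have "poly N (\<zeta> ^ j * s) = (\<Prod>k<p. poly P (\<zeta> ^ (k + j) * s))"
        by (simp add: pN power_add mult_ac)
      also have "\<dots> = (\<Prod>k<p. poly P (\<zeta> ^ k * s))"
        by (rule prod_shift) (simp add: power_add zeta_p)
      finally show ?thesis by (simp add: pN)
    qed
    have "(\<Sum>k<p. poly N (\<zeta> ^ k * s)) \<in> K"
      by (rule sum_conjugates_in[OF _ s_p N]) unfold_locales
    then have "of_nat p * poly N s \<in> K" by (simp add: inv)
    then have "of_nat p * poly N s / of_nat p \<in> K" using divide of_nat by blast
    then have NK: "poly N s \<in> K" using p_pos by simp
    have "poly P (\<zeta> ^ k * s) \<noteq> 0" for k
      using root_conjugate'[OF P(1), of k 0] False P(2) by auto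
    then have N0: "poly N s \<noteq> 0" by (simp add: pN)
    define M where "M = (\<Prod>k\<in>{1..<p}. P \<circ>\<^sub>p [:0, \<zeta> ^ k:])"
    have M: "M \<in> polys_over K" by (auto simp: M_def intro: polys_prod polys_scale P)
    have "poly N s = x * poly M s"
      using p_pos by (simp add: pN M_def poly_prod poly_pcompose P(2) mult.commute prod.atLeast_Suc_lessThan flip: atLeast0LessThan)
    then have "inverse x = inverse (poly N s) * poly M s"
      using N0 by (simp add: field_simps)
    then show ?thesis using mult K_subset_adj inverse[OF NK] adjI[OF M] by auto
  qed
qed

end

context radical_step
begin

text \<open>Let \<open>h\<close> be a monic factor of \<open>f\<close> over \<open>K(s)\<close> of least positive degree. Its conjugates under
  \<open>s \<mapsto> \<zeta>\<^sup>k s\<close> divide \<open>f\<close>, their root sets coincide or are disjoint, and their product has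
  coefficients in \<open>K\<close>, so they cover all roots of \<open>f\<close>. Hence \<open>degree h\<close> divides the prime
  \<open>degree f\<close>.\<close>

lemma roots_parametrized:
  assumes f: "f \<in> polys_over K" "lead_coeff f = 1" "prime (degree f)"
    and full: "roots_full_degree K f" and nfull: "\<not> roots_full_degree adj f"
  obtains g where "g \<in> polys_over K" "{z. poly f z = 0} = (\<lambda>k. poly g (\<zeta> ^ k * s)) ` {..<p}"
    "inj_on (\<lambda>k. poly g (\<zeta> ^ k * s)) {..<p}"
proof -
  interpret L: complex_subfield adj by (rule adj_subfield)
  have f0: "f \<noteq> 0" using f(2) by auto
  define n where "n = degree f"
  have n1: "n > 1" using prime_gt_1_nat[OF f(3)] by (simp add: n_def)
  define S where "S = {P. P \<in> polys_over adj \<and> P \<noteq> 0 \<and> (\<exists>z. poly f z = 0 \<and> poly P z = 0)}"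
  obtain P\<^sub>0 where P\<^sub>0: "P\<^sub>0 \<in> S" "degree P\<^sub>0 < n"
    using nfull unfolding roots_full_degree_def S_def n_def by (auto simp: not_le)
  then obtain m where m: "m \<in> S" and minm: "\<And>Q. Q \<in> S \<Longrightarrow> degree m \<le> degree Q"
    using ex_has_least_nat[of "\<lambda>P. P \<in> S" P\<^sub>0 degree] by blast
  define d where "d = degree m"
  have dn: "d < n" using minm[OF P\<^sub>0(1)] P\<^sub>0(2) by (simp add: d_def)
  have lc: "lead_coeff m \<noteq> 0" "inverse (lead_coeff m) \<in> adj"
    using m by (auto simp: S_def polys_over_def intro: L.inverse)
  define h where "h = smult (inverse (lead_coeff m)) m"
  have hadj: "h \<in> polys_over adj" and h0: "h \<noteq> 0" and dh: "degree h = d" and lh: "lead_coeff h = 1"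
    using m lc by (auto simp: h_def S_def d_def intro: L.polys_smult)
  have min: "d \<le> degree Q" if "Q \<in> polys_over adj" "Q \<noteq> 0" "poly f z = 0" "poly Q z = 0" for Q z
    using minm[of Q] that by (auto simp: S_def d_def)
  obtain z where z: "poly f z = 0" "poly h z = 0" using m by (auto simp: S_def h_def)
  have fadj: "f \<in> polys_over adj" using f(1) polys_over_mono[OF K_subset_adj] by blast
  obtain q where q: "q \<in> polys_over adj" "f = q * h"
    using L.minimal_poly_dvd[OF hadj h0 z(2) _ fadj z(1)] min[OF _ _ z(1)] dh by metis
  have "\<forall>i. \<exists>g. g \<in> polys_over K \<and> coeff h i = poly g s"
    using hadj unfolding polys_over_def[of adj] by (auto simp: adj_def image_iff Bex_def)
  then obtain G where G: "\<And>i. G i \<in> polys_over K" "\<And>i. coeff h i = poly (G i) s" by metis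
  have "\<forall>i. \<exists>g. g \<in> polys_over K \<and> coeff q i = poly g s"
    using q(1) unfolding polys_over_def[of adj] by (auto simp: adj_def image_iff Bex_def)
  then obtain U where U: "\<And>i. U i \<in> polys_over K" "\<And>i. coeff q i = poly (U i) s" by metis
  \<comment> \<open>\<open>H k\<close> and \<open>Q k\<close> are the images of h and q under s
    \<mapsto> \<open>\<zeta> ^ k * s\<close>; the leading coefficient of \<open>H k\<close> is
    entered as a literal 1 to keep it monic of degree d.\<close>
  define H where "H k = Poly (map (\<lambda>i. poly (G i) (\<zeta> ^ k * s)) [0..<d] @ [1])" for k :: nat
  define Q where "Q k = Poly (map (\<lambda>i. poly (U i) (\<zeta> ^ k * s)) [0..<Suc (degree q)])" for k :: nat
  \<comment> \<open>Outside the degree range \<open>G i\<close> and \<open>U i\<close> are only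
    known to vanish at s. With these representatives the coefficient formulas \<open>cH\<close> and
    \<open>cQ\<close> hold for every index.\<close>
  define G' where "G' i = (if i < d then G i else if i = d then 1 else 0)" for i
  define U' where "U' i = (if i \<le> degree q then U i else 0)" for i
  have G'K: "G' i \<in> polys_over K" for i
    using G(1) polys_zero polys_const[OF one, folded one_pCons] by (auto simp: G'_def)
  have U'K: "U' i \<in> polys_over K" for i using U(1) polys_zero by (auto simp: U'_def)
  have cH: "coeff (H k) i = poly (G' i) (\<zeta> ^ k * s)" for k i
    by (auto simp: H_def G'_def nth_default_def nth_append)
  have cQ: "coeff (Q k) i = poly (U' i) (\<zeta> ^ k * s)" for k i
    by (auto simp: Q_def U'_def nth_default_def simp del: upt_Suc)
  have h_eq: "coeff h i = poly (G' i) s" for i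
  proof (cases "i < d")
    case False
    then show ?thesis using lh dh coeff_eq_0[of h i] by (cases "i = d") (auto simp: G'_def)
  qed (simp add: G'_def G(2))
  have q_eq: "coeff q i = poly (U' i) s" for i
    by (cases "i \<le> degree q") (auto simp: U'_def U(2) coeff_eq_0 simp flip: U(2))
  have dH: "degree (H k) = d" and lH: "lead_coeff (H k) = 1" for k
  proof -
    have "coeff (H k) d = 1" by (simp add: cH G'_def)
    moreover have "degree (H k) \<le> d" by (rule degree_le) (simp add: cH G'_def)
    ultimately show "degree (H k) = d" by (metis le_antisym le_degree zero_neq_one)
    then show "lead_coeff (H k) = 1" using \<open>coeff (H k) d = 1\<close> by simp
  qed
  have H0: "H k \<noteq> 0" for k using lH[of k] by auto
  have H_0: "H 0 = h" by (rule poly_eqI) (simp add: cH h_eq)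
  have Hadj: "H k \<in> polys_over adj" for k
    unfolding polys_over_def by (auto simp: cH intro: conj_in_adj G'K)
  have fac: "f = Q k * H k" for k
  proof (rule poly_eqI)
    fix i
    \<comment> \<open>One coefficient of f = q * h, read as a polynomial relation for s over K,
      transfers to the conjugates of s.\<close>
    define E where "E = (\<Sum>j\<le>i. U' j * G' (i - j)) - [:coeff f i:]"
    have E: "E \<in> polys_over K"
      using f(1) unfolding E_def
      by (intro polys_diff polys_sum polys_mult G'K U'K polys_const) (auto simp: polys_over_def)
    have "poly E s = 0"
      using arg_cong[OF q(2), of "\<lambda>P. coeff P i"] by (simp add: E_def poly_sum coeff_mult h_eq q_eq)
    then have "poly E (\<zeta> ^ k * s) = 0" using root_conjugate[OF E] by blast
    then show "coeff f i = coeff (Q k * H k) i"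
      by (simp add: E_def poly_sum coeff_mult cH cQ)
  qed
  define N where "N = (\<Prod>k<p. H k)"
  have NK: "N \<in> polys_over K"
  proof -
    \<comment> \<open>One polynomial \<open>e\<close> has to serve all shifts j: the product over
      all k is invariant under shifts, so its coefficients equal the average of their conjugates and
      lie in K.\<close>
    have "\<exists>e. e \<in> polys_over K \<and> (\<forall>j. coeff (\<Prod>k\<in>A. H (k + j)) i = poly e (\<zeta> ^ j * s))"
      if "finite A" for A i
      using that
    proof (induction A arbitrary: i rule: finite_induct)
      case empty
      show ?case
        by (rule exI[of _ "[:if i = 0 then 1 else 0:]"])
           (auto intro!: polys_const polys_zero one zero simp: coeff_1)
    next
      case (insert a A)
      from insert.IH obtain e where e: "\<And>i. e i \<in> polys_over K"
        "\<And>i j. coeff (\<Prod>k\<in>A. H (k + j)) i = poly (e i) (\<zeta> ^ j * s)" by metis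
      define E where "E = (\<Sum>l\<le>i. (G' l \<circ>\<^sub>p [:0, \<zeta> ^ a:]) * e (i - l))"
      have "E \<in> polys_over K" unfolding E_def
        by (intro polys_sum polys_mult polys_scale G'K e)
      moreover have "coeff (\<Prod>k\<in>insert a A. H (k + j)) i = poly E (\<zeta> ^ j * s)" for j
        using insert.hyps
        by (simp add: coeff_mult E_def poly_sum poly_pcompose cH e(2) power_add mult_ac)
      ultimately show ?case by blast
    qed
    then obtain e where e: "\<And>i. e i \<in> polys_over K"
      "\<And>i j. coeff (\<Prod>k<p. H (k + j)) i = poly (e i) (\<zeta> ^ j * s)" by (metis finite_lessThan)
    have shift: "(\<Prod>k<p. H (k + j)) = N" for j
      unfolding N_def by (rule prod_shift) (rule poly_eqI, simp add: cH power_add zeta_p)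
    show ?thesis unfolding polys_over_def mem_Collect_eq
    proof
      fix i
      have "(\<Sum>k<p. poly (e i) (\<zeta> ^ k * s)) \<in> K"
        by (rule sum_conjugates_in[OF _ s_p e(1)]) unfold_locales
      then have "of_nat p * coeff N i \<in> K" by (simp add: shift flip: e(2))
      then have "of_nat p * coeff N i / of_nat p \<in> K" using divide of_nat by blast
      then show "coeff N i \<in> K" using p_pos by simp
    qed
  qed
  have "poly N z = 0"
    using z(2) p_pos by (auto simp: N_def poly_prod H_0 intro!: bexI[of _ 0])
  then obtain A where "N = A * f"
    using minimal_poly_dvd[OF f(1) f0 z(1) _ NK] full z(1) unfolding roots_full_degree_def by metis
  then have cover: "\<exists>k<p. poly (H k) w = 0" if "poly f w = 0" for w
  proof -
    have "poly N w = 0" using that \<open>N = A * f\<close> by simp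
    then show ?thesis by (auto simp: N_def poly_prod)
  qed
  have sub: "poly f w = 0" if "poly (H k) w = 0" for k w
    using that by (subst fac[of k]) simp
  \<comment> \<open>The difference of two distinct monic polynomials of degree d has smaller degree;
    a common root would contradict the minimality of d.\<close>
  have disj: "H i = H j" if "poly (H i) w = 0" "poly (H j) w = 0" for i j w
  proof (rule ccontr)
    assume ne: "H i \<noteq> H j"
    have "d \<le> degree (H i - H j)"
      using min[OF L.polys_diff[OF Hadj Hadj] _ sub[OF that(1)]] that ne by auto
    moreover have "degree (H i - H j) \<le> d" by (rule degree_diff_le) (simp_all add: dH)
    moreover have "coeff (H i - H j) d = 0" using lH[of i] lH[of j] by (simp add: dH)
    ultimately show False using ne by (metis leading_coeff_0_iff le_antisym right_minus_eq)
  qed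
  have sqf: "rsquarefree f"
    using rsquarefree_if_full_degree[OF f(1) _ full] n1 by (simp add: n_def)
  define R where "R P = {w. poly P w = 0}" for P :: "complex poly"
  have cardR: "card (R (H k)) = d" for k
    unfolding R_def using card_roots_rsquarefree[OF rsquarefree_dvd[OF sqf, of "H k"]] fac[of k] dH by (metis dvd_triv_right)
  have un: "R f = (\<Union>P\<in>H ` {..<p}. R P)"
    using cover sub unfolding R_def by blast
  have "n = card (R f)" using card_roots_rsquarefree[OF sqf] by (simp add: R_def n_def)
  also have "\<dots> = (\<Sum>P\<in>H ` {..<p}. card (R P))"
    unfolding un
  proof (rule card_UN_disjoint)
    show "\<forall>P\<in>H ` {..<p}. finite (R P)" using H0 by (auto simp: R_def intro: poly_roots_finite)
    show "\<forall>P\<in>H ` {..<p}. \<forall>P'\<in>H ` {..<p}. P \<noteq> P' \<longrightarrow> R P \<inter> R P' = {}"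
      using disj by (fastforce simp: R_def)
  qed auto
  also have "\<dots> = card (H ` {..<p}) * d" using cardR by (subst sum.cong[OF refl, of _ _ "\<lambda>_. d"]) auto
  finally have "d dvd n" by simp
  then have d1: "d = 1" using f(3) dn by (auto simp: n_def prime_nat_iff)
  define g where "g = - G' 0"
  have gK: "g \<in> polys_over K" using polys_diff[OF polys_zero G'K[of 0]] by (simp add: g_def)
  have H_eq: "H k = [:- poly g (\<zeta> ^ k * s), 1:]" for k
    by (rule poly_eqI) (auto simp: cH g_def G'_def d1 coeff_pCons split: nat.split)
  then have R_eq: "R (H k) = {poly g (\<zeta> ^ k * s)}" for k
    by (auto simp: R_def add_eq_0_iff2)
  have "inj_on (\<lambda>k. poly g (\<zeta> ^ k * s)) {..<p}"
  \<comment> \<open>A coincidence makes g(s) invariant under a nontrivial shift of the index, hence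
    under all shifts since p is prime. Then g(s) equals its average and is a root of f in K.\<close>
  proof (rule inj_onI, rule ccontr)
    fix i j assume ij: "i \<in> {..<p}" "j \<in> {..<p}" "poly g (\<zeta> ^ i * s) = poly g (\<zeta> ^ j * s)" "i \<noteq> j"
    obtain e where e: "coprime e p" "\<And>w. poly (g \<circ>\<^sub>p [:0, \<zeta> ^ e:]) (\<zeta> ^ w * s) = poly g (\<zeta> ^ w * s)"
    proof -
      \<comment> \<open>j - i modulo p, without truncation.\<close>
      define e where "e = p + j - i"
      have "\<not> p dvd e"
      proof
        assume "p dvd e"
        then have "[p + j = i] (mod p)" using ij by (subst cong_altdef_nat) (auto simp: e_def)
        then show False using ij by (simp add: cong_def)
      qed
      then have cop: "coprime e p" using p by (meson coprime_commute prime_imp_coprime)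
      have "e + i = p + j" using ij by (simp add: e_def)
      then have "\<zeta> ^ e * \<zeta> ^ i = \<zeta> ^ p * \<zeta> ^ j" by (metis power_add)
      then have "\<zeta> ^ e * \<zeta> ^ i = \<zeta> ^ j" by (simp add: zeta_p)
      then have "poly (g \<circ>\<^sub>p [:0, \<zeta> ^ e:]) (\<zeta> ^ i * s) = poly g (\<zeta> ^ i * s)"
        using ij(3) by (simp add: poly_pcompose mult_ac)
      then have "poly (g \<circ>\<^sub>p [:0, \<zeta> ^ e:] - g) (\<zeta> ^ i * s) = 0" by simp
      then have "poly (g \<circ>\<^sub>p [:0, \<zeta> ^ e:] - g) (\<zeta> ^ w * s) = 0" for w
        by (rule root_conjugate'[rotated]) (intro polys_diff polys_scale gK)
      then show ?thesis using that[OF cop] by simp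
    qed
    have iter: "poly g (\<zeta> ^ (e * k) * s) = poly g s" for k
    proof (induction k)
      case (Suc k)
      have "poly g (\<zeta> ^ (e * Suc k) * s) = poly (g \<circ>\<^sub>p [:0, \<zeta> ^ e:]) (\<zeta> ^ (e * k) * s)"
        by (simp add: poly_pcompose power_add mult_ac)
      then show ?case using e(2) Suc by simp
    qed simp
    have all: "poly g (\<zeta> ^ k * s) = poly g s" for k
    proof -
      obtain x where "[e * x = 1] (mod p)" using cong_solve_coprime_nat[OF e(1)] by auto
      then have "[e * x * k = 1 * k] (mod p)" by (rule cong_scalar_right)
      then obtain l where "[e * l = k] (mod p)" by (metis mult.assoc mult_1)
      then have "\<zeta> ^ (e * l) = \<zeta> ^ k" by (simp add: zeta_pow_eq_iff)
      then show ?thesis using iter[of l] by simp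
    qed
    have "(\<Sum>k<p. poly g (\<zeta> ^ k * s)) \<in> K"
      by (rule sum_conjugates_in[OF _ s_p gK]) unfold_locales
    then have "of_nat p * poly g s / of_nat p \<in> K" unfolding all by (intro divide of_nat) simp
    then have gs: "poly g s \<in> K" using p_pos by simp
    have "poly f (poly g s) = 0" using sub[of 0 "poly g s"] H_eq[of 0] by simp
    moreover have "[:- poly g s, 1:] \<in> polys_over K"
      using gs one zero minus by (auto simp: polys_over_def coeff_pCons split: nat.split)
    ultimately have "degree f \<le> degree [:- poly g s, 1:]"
      using full unfolding roots_full_degree_def by fastforce
    then show False using n1 by (simp add: n_def)
  qed
  moreover have "{z. poly f z = 0} = (\<lambda>k. poly g (\<zeta> ^ k * s)) ` {..<p}"
    using un unfolding R_def[of f] by (auto simp: R_eq)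
  ultimately show ?thesis using that gK by blast
qed

end

section \<open>Kronecker's theorem\<close>

context radical_step
begin

text \<open>Otherwise the roots are \<alpha> k = g(\<zeta>^k s) with k modulo the odd prime p =
  \<open>degree f\<close>. If s is real, conjugation acts as k \<mapsto> m - k, which fixes only one
  index, against two real roots. If s * cnj s lies in K, it acts as k \<mapsto> k + m, which fixes
  no index or all of them, against a real and a nonreal root.\<close>

lemma adj_roots_full_degree:
  assumes K: "cnj ` K \<subseteq> K"
    and f: "f \<in> polys_over K" "lead_coeff f = 1" "prime (degree f)" "odd (degree f)"
      "roots_full_degree K f"
    and real: "\<And>z. poly f z = 0 \<Longrightarrow> poly f (cnj z) = 0"
    and r: "poly f r\<^sub>1 = 0" "r\<^sub>1 \<in> \<real>" "poly f r\<^sub>2 = 0" "r\<^sub>2 \<in> \<real>" "r\<^sub>1 \<noteq> r\<^sub>2" "poly f w = 0" "w \<notin> \<real>"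
    and s: "s \<in> \<real> \<or> s * cnj s \<in> K"
  shows "roots_full_degree adj f"
proof (rule ccontr)
  assume "\<not> roots_full_degree adj f"
  then obtain g where g: "g \<in> polys_over K"
    and roots: "{z. poly f z = 0} = (\<lambda>k. poly g (\<zeta> ^ k * s)) ` {..<p}"
    and inj: "inj_on (\<lambda>k. poly g (\<zeta> ^ k * s)) {..<p}"
    using roots_parametrized[OF f(1,2,3,5)] by metis
  define \<alpha> where "\<alpha> k = poly g (\<zeta> ^ k * s)" for k
  have \<alpha>_mod: "\<alpha> (k mod p) = \<alpha> k" for k by (simp add: \<alpha>_def zeta_mod)
  have \<alpha>_eq: "[i = j] (mod p)" if "\<alpha> i = \<alpha> j" for i j
  proof -
    have "\<alpha> (i mod p) = \<alpha> (j mod p)" using that by (simp add: \<alpha>_mod)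
    then show ?thesis
      using inj p_pos unfolding \<alpha>_def[symmetric] by (auto simp: inj_on_def cong_def)
  qed
  have \<alpha>_root: "poly f (\<alpha> k) = 0" for k
  proof -
    have "\<alpha> (k mod p) \<in> {z. poly f z = 0}" unfolding roots \<alpha>_def[symmetric] using p_pos by auto
    then show ?thesis by (simp add: \<alpha>_mod)
  qed
  have ex: "\<exists>k. z = \<alpha> k" if "poly f z = 0" for z
    using that roots unfolding \<alpha>_def[symmetric] by auto
  have "card {z. poly f z = 0} = p" unfolding roots using inj by (simp add: card_image)
  moreover have "rsquarefree f"
    using rsquarefree_if_full_degree[OF f(1) prime_gt_1_nat[OF f(3)] f(5)] .
  ultimately have "p = degree f" using card_roots_rsquarefree by metis
  then have odd: "odd p" using f(4) by simp
  define g' where "g' = map_poly cnj g"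
  have g': "g' \<in> polys_over K" using g K by (auto simp: g'_def polys_over_def coeff_map_poly)
  have cnj_g: "cnj (poly g x) = poly g' (cnj x)" for x by (simp add: g'_def)
  have zc: "\<zeta> * cnj \<zeta> = 1"
  proof -
    have "cmod \<zeta> ^ p = 1" by (simp add: zeta_p flip: norm_power)
    then have "cmod \<zeta> = 1" using p_pos using power_eq_imp_eq_base[of "cmod \<zeta>" p 1] by simp
    then show ?thesis by (simp add: complex_norm_square[symmetric])
  qed
  \<comment> \<open>Conjugation inverts \<zeta>, and the exponent p - 1 plays the role of
    -1.\<close>
  have cnj_zeta: "cnj (\<zeta> ^ i) = \<zeta> ^ ((p - 1) * i)" for i
  proof -
    have "\<zeta> ^ i * \<zeta> ^ ((p - 1) * i) = (\<zeta> ^ p) ^ i"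
      using p_pos by (simp add: algebra_simps flip: power_add power_mult)
    also have "\<dots> = \<zeta> ^ i * cnj (\<zeta> ^ i)"
      by (simp add: zeta_p zc flip: power_mult_distrib)
    finally show ?thesis using zeta_0 by simp
  qed
  have cnj_\<alpha>: "cnj (\<alpha> i) = poly g' (\<zeta> ^ ((p - 1) * i) * cnj s)" for i
    by (simp only: \<alpha>_def cnj_g complex_cnj_mult cnj_zeta)
  obtain m where m: "cnj (\<alpha> 0) = \<alpha> m" using ex[OF real[OF \<alpha>_root]] by blast
  show False
  proof (cases "s \<in> \<real>")
    case True
    then have cs: "cnj s = s" by (simp add: Reals_cnj_iff)
    have "poly g' s = poly (g \<circ>\<^sub>p [:0, \<zeta> ^ m:]) s"
      using m cnj_\<alpha>[of 0] by (simp add: \<alpha>_def cs poly_pcompose mult.commute)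
    then have "poly g' (\<zeta> ^ j * s) = poly (g \<circ>\<^sub>p [:0, \<zeta> ^ m:]) (\<zeta> ^ j * s)" for j
      by (rule conjugates_eq[OF g' polys_scale[OF g]])
    then have reflect: "cnj (\<alpha> i) = \<alpha> ((p - 1) * i + m)" for i
      unfolding cnj_\<alpha> by (simp add: \<alpha>_def cs poly_pcompose power_add mult_ac)
    have fixed: "[2 * i = m] (mod p)" if "\<alpha> i \<in> \<real>" for i
    proof -
      have "\<alpha> i = \<alpha> ((p - 1) * i + m)" using that reflect[of i] by (simp add: Reals_cnj_iff)
      then have "[i + i = (p - 1) * i + m + i] (mod p)" by (intro cong_add \<alpha>_eq) auto
      also have "(p - 1) * i + m + i = p * i + m" using p_pos by (cases p) auto
      also have "[p * i + m = m] (mod p)" by (simp add: cong_def)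
      finally show ?thesis by (simp add: mult_2)
    qed
    obtain i j where ij: "r\<^sub>1 = \<alpha> i" "r\<^sub>2 = \<alpha> j" using ex r by metis
    have "[2 * i = 2 * j] (mod p)"
      using fixed[of i] fixed[of j] r ij by (metis cong_sym cong_trans)
    then have "[i = j] (mod p)"
      using odd by (simp add: cong_mult_lcancel_nat coprime_left_2_iff_odd)
    then have "\<alpha> i = \<alpha> j" using \<alpha>_mod by (metis cong_def)
    then show False using ij r by simp
  next
    case False
    with s have t: "s * cnj s \<in> K" by simp
    \<comment> \<open>This gives cnj s = \<kappa> * s^(p-1). Conjugation and the (p-1)-th power both
      invert \<zeta>^i, so cnj (\<alpha> i) is a polynomial over K in \<zeta>^i * s, and the
      direction of the index is kept.\<close>
    define \<kappa> where "\<kappa> = s * cnj s / s ^ p"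
    have \<kappa>: "\<kappa> \<in> K" unfolding \<kappa>_def by (intro divide t s_p)
    have cs: "cnj s = \<kappa> * s ^ (p - 1)"
    proof -
      have "s ^ p = s * s ^ (p - 1)" using p_pos by (simp add: power_eq_if)
      then show ?thesis using s_0 by (simp add: \<kappa>_def)
    qed
    define P where "P = g' \<circ>\<^sub>p monom \<kappa> (p - 1)"
    have PK: "P \<in> polys_over K" unfolding P_def by (intro polys_pcompose g' polys_monom \<kappa>)
    have "poly P s = poly (g \<circ>\<^sub>p [:0, \<zeta> ^ m:]) s"
      using m cnj_\<alpha>[of 0] by (simp add: \<alpha>_def cs P_def poly_pcompose poly_monom mult.commute)
    then have "poly P (\<zeta> ^ j * s) = poly (g \<circ>\<^sub>p [:0, \<zeta> ^ m:]) (\<zeta> ^ j * s)" for j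
      by (rule conjugates_eq[OF PK polys_scale[OF g]])
    moreover have "cnj (\<alpha> i) = poly P (\<zeta> ^ i * s)" for i
      unfolding cnj_\<alpha>
      by (simp add: cs P_def poly_pcompose poly_monom power_mult_distrib mult_ac flip: power_mult)
    ultimately have transl: "cnj (\<alpha> i) = \<alpha> (i + m)" for i
      by (simp add: \<alpha>_def poly_pcompose power_add mult_ac)
    obtain i where i: "r\<^sub>1 = \<alpha> i" using ex r by metis
    then have "\<alpha> i = \<alpha> (i + m)" using transl[of i] r by (simp add: Reals_cnj_iff)
    then have "[i + 0 = i + m] (mod p)" using \<alpha>_eq by simp
    then have "[m = 0] (mod p)" by (simp only: cong_add_lcancel_nat cong_sym_eq)
    then have "\<zeta> ^ m = 1" by (simp add: zeta_pow_1_iff cong_0_iff)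
    then have "cnj (\<alpha> k) = \<alpha> k" for k
      using transl[of k] by (simp add: \<alpha>_def power_add)
    then show False using ex[OF r(6)] r(7) by (metis Reals_cnj_iff)
  qed
qed

end

section \<open>Numbers expressible by radicals, and roots of unity by prime radicals\<close>

inductive_set radical_numbers :: "complex set" where
  of_int: "of_int m \<in> radical_numbers"
| add: "x \<in> radical_numbers \<Longrightarrow> y \<in> radical_numbers \<Longrightarrow> x + y \<in> radical_numbers"
| diff: "x \<in> radical_numbers \<Longrightarrow> y \<in> radical_numbers \<Longrightarrow> x - y \<in> radical_numbers"
| mult: "x \<in> radical_numbers \<Longrightarrow> y \<in> radical_numbers \<Longrightarrow> x * y \<in> radical_numbers"
| divide: "x \<in> radical_numbers \<Longrightarrow> y \<in> radical_numbers \<Longrightarrow> x / y \<in> radical_numbers"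
| root: "x \<in> radical_numbers \<Longrightarrow> k \<ge> 1 \<Longrightarrow> y ^ k = x \<Longrightarrow> y \<in> radical_numbers"

text \<open>The \<open>root\<close> rule admits every k-th root rather than a chosen branch, so
  conjugating a derivation gives another derivation.\<close>

lemma radical_numbers_cnj: "x \<in> radical_numbers \<Longrightarrow> cnj x \<in> radical_numbers"
proof (induction rule: radical_numbers.induct)
  case (root x k y)
  then show ?case using radical_numbers.root[of "cnj x" k "cnj y"] by (metis complex_cnj_power)
qed (auto intro: radical_numbers.intros)

lemma cnj_Rats: "x \<in> \<rat> \<Longrightarrow> cnj x = x"
  by (elim Rats_cases') auto

lemma cis_root_of_unity: "n > 0 \<Longrightarrow> cis (2 * pi / real n) ^ n = 1"
  by (simp add: DeMoivre)

lemma cis_root_of_unity_ne_1: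
  assumes "n > 1"
  shows "cis (2 * pi / real n) \<noteq> 1"
proof
  assume "cis (2 * pi / real n) = 1"
  then have "cos (2 * pi / real n) = cos 0" by (metis cis.simps(1) cos_zero one_complex.sel(1))
  moreover have "0 < 2 * pi / real n" "2 * pi / real n \<le> pi" using assms by (auto simp: field_simps)
  ultimately show False using cos_inj_pi[of "2 * pi / real n" 0] by simp
qed

text \<open>The inductive step over primes \<open>p\<close> uses Lagrange resolvents: with \<open>g\<close> a primitive root modulo \<open>p\<close>,
  \<open>\<omega>\<close> a \<open>(p-1)\<close>-th and \<open>z\<close> a \<open>p\<close>-th root of unity, replacing \<open>z\<close> by \<open>z ^ g\<close> multiplies
  \<open>\<Sum>i<p-1. \<omega>\<^sup>i z ^ (g ^ i)\<close> by \<open>\<omega>\<^sup>-\<^sup>1\<close>. So its \<open>(p-1)\<close>-th power is unchanged, hence lies in the field.\<close>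

locale prime_radical_closed = complex_subfield F for F +
  assumes prime_root: "prime p \<Longrightarrow> \<zeta> \<in> F \<Longrightarrow> \<zeta> ^ p = 1 \<Longrightarrow> \<zeta> \<noteq> 1 \<Longrightarrow> a ^ p \<in> F \<Longrightarrow> a \<in> F"
begin

text \<open>Peel off one prime factor of n at a time. Asking only for roots of unity of order up to
  n avoids a circle: \<open>prime_unity_root\<close> uses this for n = p - 1 inside the induction on
  p.\<close>

lemma root_if_unity_roots:
  assumes "n > 0" "a ^ n \<in> F" "\<And>k z. 0 < k \<Longrightarrow> k \<le> n \<Longrightarrow> z ^ k = 1 \<Longrightarrow> z \<in> F"
  shows "a \<in> F"
  using assms
proof (induction n arbitrary: a rule: less_induct)
  case (less n)
  show ?case
  proof (cases "n = 1")
    case False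
    then obtain q where q: "prime q" "q dvd n" using prime_factor_nat by blast
    then obtain m where m: "n = q * m" by blast
    have m0: "m > 0" using m less.prems(1) by auto
    have q1: "q > 1" using q prime_gt_1_nat by blast
    have qn: "q \<le> n" and mn: "m < n" using m m0 q1 by auto
    have "cis (2 * pi / real q) \<in> F"
      using less.prems(3)[of q] qn q1 cis_root_of_unity[of q] by simp
    then have "a ^ m \<in> F"
      using prime_root[OF q(1) _ cis_root_of_unity cis_root_of_unity_ne_1, of "a ^ m"] q1 less.prems(2)
      by (simp add: m mult.commute flip: power_mult)
    then show ?thesis using less.IH[of m a] mn m0 less.prems(3) by fastforce
  qed (use less.prems in auto)
qed

lemma prime_unity_root:
  assumes p: "prime p" and z: "z ^ p = 1" "z \<noteq> 1"
    and IH: "\<And>k w. 0 < k \<Longrightarrow> k < p \<Longrightarrow> w ^ k = 1 \<Longrightarrow> w \<in> F"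
  shows "z \<in> F"
proof (cases "p = 2")
  case True
  then have "z = - 1" using z by (simp add: power2_eq_1_iff)
  then show ?thesis using minus[OF one] by simp
next
  case False
  interpret Z: prime_root_of_unity p z using p z by unfold_locales
  define n where "n = p - 1"
  have n: "n > 1" "p = Suc n" using p False prime_gt_1_nat[OF p] by (auto simp: n_def)
  define \<omega> where "\<omega> = cis (2 * pi / real n)"
  have \<omega>n: "\<omega> ^ n = 1" unfolding \<omega>_def using n by (intro cis_root_of_unity) auto
  have \<omega>F: "\<omega> \<in> F" using IH[of n \<omega>] n \<omega>n by simp
  have \<omega>0: "\<omega> \<noteq> 0" by (simp add: \<omega>_def)
  obtain g where g: "residue_primroot p g"
    using prime_primitive_root_exists[of p] p prime_gt_1_nat[OF p] by auto
  have cop: "coprime p g" using g by (simp add: residue_primroot_def)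
  have gn: "[g ^ n = 1] (mod p)"
    using fermat_theorem[OF p, of g] cop p unfolding n_def
    by (metis coprime_absorb_left not_prime_unit)
  \<comment> \<open>The index j runs over all powers of \<omega> so that the resolvents can be
    inverted; t tracks the substitution z \<mapsto> z^t.\<close>
  define R where "R j t = (\<Sum>i<n. (\<omega> ^ j) ^ i * z ^ (t * g ^ i))" for j t
  have R_shift: "\<omega> ^ j * R j (t * g) = R j t" for j t
  proof -
    define T where "T i = (\<omega> ^ j) ^ i * z ^ (t * g ^ i)" for i
    have "[t * g ^ n = t * 1] (mod p)" by (rule cong_scalar_left[OF gn])
    then have "z ^ (t * g ^ n) = z ^ t" using Z.zeta_pow_eq_iff by simp
    moreover have "(\<omega> ^ j) ^ n = 1" by (metis \<omega>n mult.commute power_mult power_one)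
    ultimately have Tn: "T n = T 0" by (simp add: T_def)
    have "\<omega> ^ j * R j (t * g) = (\<Sum>i<n. T (Suc i))"
      by (simp add: R_def T_def sum_distrib_left mult_ac)
    also have "\<dots> = (\<Sum>i<n. T i)"
      using sum.lessThan_Suc_shift[of T n] sum.lessThan_Suc[of T n] Tn by simp
    finally show ?thesis by (simp add: R_def T_def)
  qed
  have R_pow: "R j (g ^ k) ^ n = R j 1 ^ n" for j k
  proof (induction k)
    case (Suc k)
    have "R j (g ^ k) ^ n = (\<omega> ^ j) ^ n * R j (g ^ Suc k) ^ n"
      by (subst R_shift[symmetric]) (simp add: power_mult_distrib mult.commute)
    moreover have "(\<omega> ^ j) ^ n = 1" by (metis \<omega>n mult.commute power_mult power_one)
    ultimately show ?case using Suc by simp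
  qed simp
  have R_in: "R j 1 \<in> F" for j
  proof (rule root_if_unity_roots[of n])
    show "n > 0" using n by simp
    show "w \<in> F" if "0 < k" "k \<le> n" "w ^ k = 1" for k w using IH[of k w] that n by simp
    define P where "P = (\<Sum>i<n. monom ((\<omega> ^ j) ^ i) (g ^ i)) ^ n"
    have P: "P \<in> polys_over F"
      unfolding P_def by (intro polys_power polys_sum polys_monom power \<omega>F)
    have PR: "poly P (z ^ t) = R j t ^ n" for t
      by (simp add: P_def R_def poly_sum poly_monom flip: power_mult)
    have bij: "bij_betw (\<lambda>i. g ^ i mod p) {..<n} {1..<p}"
    proof -
      have "totatives p = {1..<p}" using p by (auto simp: totatives_prime)
      moreover have "totient p = n" using p by (simp add: totient_prime n_def)
      ultimately show ?thesis
        using residue_primroot_is_generator[OF prime_gt_1_nat[OF p] g] by simp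
    qed
    \<comment> \<open>The exponents g^k run through all nonzero residues. Adding the term t = 0
      completes a sum over all p-th roots of unity, which lies in F although z is not yet known
      to.\<close>
    have "of_nat n * R j 1 ^ n = (\<Sum>k<n. R j (g ^ k) ^ n)" by (simp add: R_pow)
    also have "\<dots> = (\<Sum>k<n. poly P (z ^ (g ^ k mod p)))" by (simp add: Z.zeta_mod PR)
    also have "\<dots> = (\<Sum>t\<in>{1..<p}. poly P (z ^ t))"
      by (rule sum.reindex_bij_betw[OF bij])
    also have "\<dots> = (\<Sum>t<p. poly P (z ^ t * 1)) - poly P 1"
      using n by (simp add: sum.atLeast_Suc_lessThan flip: atLeast0LessThan)
    also have "\<dots> \<in> F"
      by (intro diff sum_conjugates_in poly_in P one Z.prime_root_of_unity_axioms) (simp add: one)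
    finally have "of_nat n * R j 1 ^ n / of_nat n \<in> F" using divide of_nat by blast
    then show "R j 1 ^ n \<in> F" using n by simp
  qed
  have sum0: "(\<Sum>j<n. (\<omega> ^ j) ^ i) = 0" if "0 < i" "i < n" for i
  proof -
    have "inj_on (\<lambda>k. cis (2 * pi * real k / real n)) {..<n}"
      using bij_betw_roots_unity[of n] n by (auto simp: bij_betw_def)
    then have "cis (2 * pi * real i / real n) \<noteq> cis (2 * pi * real 0 / real n)"
      using that inj_onD[of _ _ i 0] by fastforce
    then have "\<omega> ^ i \<noteq> 1" by (simp add: \<omega>_def DeMoivre mult_ac)
    moreover have "(\<omega> ^ i) ^ n = 1" by (metis \<omega>n mult.commute power_mult power_one)
    moreover have "(\<Sum>j<n. (\<omega> ^ j) ^ i) = (\<Sum>j<n. (\<omega> ^ i) ^ j)"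
      by (simp add: mult.commute flip: power_mult)
    ultimately show ?thesis by (simp add: sum_gp_strict)
  qed
  \<comment> \<open>Fourier inversion: summing over j leaves only the term i = 0, which is n *
    z.\<close>
  have "(\<Sum>j<n. R j 1) = (\<Sum>i<n. z ^ (g ^ i) * (\<Sum>j<n. (\<omega> ^ j) ^ i))"
    unfolding R_def by (subst sum.swap) (simp add: sum_distrib_left mult.commute)
  also have "\<dots> = (\<Sum>i<n. if i = 0 then z * of_nat n else 0)"
    by (rule sum.cong) (use sum0 in auto)
  also have "\<dots> = z * of_nat n" using n by simp
  finally have "z * of_nat n / of_nat n \<in> F"
    using divide[OF sum[of "{..<n}" "\<lambda>j. R j 1"] of_nat] R_in by metis
  then show ?thesis using n by simp
qed

text \<open>For n = q * m with q prime, z^q is an m-th root of unity, and z is then a q-th root of a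
  number in F, with a primitive q-th root of unity available by induction.\<close>

lemma unity_root: "n > 0 \<Longrightarrow> z ^ n = 1 \<Longrightarrow> z \<in> F"
proof (induction n arbitrary: z rule: less_induct)
  case (less n)
  show ?case
  proof (cases "prime n")
    case True
    then show ?thesis using prime_unity_root[of n z] less one by (cases "z = 1") auto
  next
    case np: False
    show ?thesis
    proof (cases "n = 1")
      case False
      then obtain q where q: "prime q" "q dvd n" using prime_factor_nat by blast
      then obtain m where m: "n = q * m" by blast
      have m1: "m > 1" using m less.prems np q(1) by (cases "m = 0"; cases "m = 1") auto
      have q1: "q > 1" using q prime_gt_1_nat by blast
      have "z ^ q \<in> F" using less.IH[of m "z ^ q"] m m1 q1 less.prems by (simp add: power_mult)
      moreover have "cis (2 * pi / real q) \<in> F"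
        using less.IH[of q] m m1 q1 cis_root_of_unity[of q] by simp
      ultimately show ?thesis
        using prime_root[OF q(1) _ cis_root_of_unity cis_root_of_unity_ne_1] q1 by simp
    qed (use less.prems one in auto)
  qed
qed

lemma radical_numbers_subset: "radical_numbers \<subseteq> F"
proof
  fix x assume "x \<in> radical_numbers"
  then show "x \<in> F"
  proof induction
    case (root x k y)
    then show ?case using root_if_unity_roots[of k y] unity_root by simp
  qed (auto intro: of_int add diff mult divide)
qed

end

text \<open>\<open>K\<close> is extendable when \<open>f\<close> stays irreducible over it. The numbers that can be adjoined to every
  extendable field form a field closed under radicals, which contains no root of \<open>f\<close>.\<close>

locale kronecker_poly =
  fixes f :: "complex poly" and r\<^sub>1 r\<^sub>2 w :: complex
  assumes f_rat: "f \<in> polys_over \<rat>" and monic: "lead_coeff f = 1"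
    and deg: "prime (degree f)" "odd (degree f)"
    and irr: "roots_full_degree \<rat> f"
    and r: "poly f r\<^sub>1 = 0" "r\<^sub>1 \<in> \<real>" "poly f r\<^sub>2 = 0" "r\<^sub>2 \<in> \<real>" "r\<^sub>1 \<noteq> r\<^sub>2" "poly f w = 0" "w \<notin> \<real>"
begin

text \<open>Stability under conjugation is carried along because
  \<open>adj_roots_full_degree\<close> conjugates coefficients.\<close>

definition extendable :: "complex set \<Rightarrow> bool" where
  "extendable K \<longleftrightarrow> complex_subfield K \<and> cnj ` K \<subseteq> K \<and> roots_full_degree K f"

lemma f_over:
  assumes "complex_subfield K"
  shows "f \<in> polys_over K"
proof -
  interpret complex_subfield K by fact
  have "x \<in> K" if "x \<in> \<rat>" for x
    using that by (elim Rats_cases') (auto intro: divide of_int)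
  then show ?thesis using f_rat by (auto simp: polys_over_def)
qed

lemma cnj_root: "poly f z = 0 \<Longrightarrow> poly f (cnj z) = 0"
proof -
  have "map_poly cnj f = f"
    using f_rat cnj_Rats by (intro poly_eqI) (auto simp: coeff_map_poly polys_over_def)
  then show "poly f z = 0 \<Longrightarrow> poly f (cnj z) = 0"
    by (metis poly_cnj complex_cnj_zero)
qed

text \<open>Either alternative for s puts cnj s into K(s), so the larger field is again stable under
  conjugation.\<close>

lemma extendable_adj:
  assumes "extendable K" "radical_step K p \<zeta> s" "s \<in> \<real> \<or> s * cnj s \<in> K"
  shows "\<exists>K'. extendable K' \<and> K \<subseteq> K' \<and> s \<in> K'"
proof -
  interpret radical_step K p \<zeta> s by fact
  interpret L: complex_subfield adj by (rule adj_subfield)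
  have K: "cnj ` K \<subseteq> K" "roots_full_degree K f" using assms(1) by (auto simp: extendable_def)
  have "cnj s \<in> adj"
  proof (cases "s \<in> \<real>")
    case True
    then show ?thesis using s_in_adj by (simp add: Reals_cnj_iff)
  next
    case False
    then have "s * cnj s / s \<in> adj" using assms(3) K_subset_adj s_in_adj by (intro L.divide) auto
    then show ?thesis using s_0 by simp
  qed
  have "cnj ` adj \<subseteq> adj"
  proof safe
    fix x assume "x \<in> adj"
    then obtain P where P: "P \<in> polys_over K" "x = poly P s" by (auto simp: adj_def)
    have "map_poly cnj P \<in> polys_over adj"
      using P(1) K(1) K_subset_adj by (auto simp: polys_over_def coeff_map_poly)
    then show "cnj x \<in> adj" using \<open>cnj s \<in> adj\<close> L.poly_in unfolding P(2) poly_cnj by blast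
  qed
  moreover have "roots_full_degree adj f"
    using adj_roots_full_degree[OF K(1) f_over monic deg K(2) cnj_root r assms(3)]
      complex_subfield_axioms by blast
  ultimately show ?thesis using adj_subfield K_subset_adj s_in_adj unfolding extendable_def by blast
qed

text \<open>First adjoin the real number a * cnj a, whose p-th power is in K, then a itself. Each
  step satisfies one alternative of \<open>extendable_adj\<close>; a step whose number is already
  present is skipped.\<close>

lemma extendable_prime_root:
  assumes "extendable K" "prime p" "\<zeta> \<in> K" "\<zeta> ^ p = 1" "\<zeta> \<noteq> 1" "a ^ p \<in> K"
  shows "\<exists>K'. extendable K' \<and> K \<subseteq> K' \<and> a \<in> K'"
proof -
  have step: "radical_step L p \<zeta> s" if "extendable L" "\<zeta> \<in> L" "s ^ p \<in> L" "s \<notin> L" for L s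
    using that assms
    by (auto simp: extendable_def radical_step_def radical_step_axioms_def
        subfield_with_root_of_unity_def subfield_with_root_of_unity_axioms_def prime_root_of_unity_def)
  define s where "s = a * cnj a"
  have "cnj (a ^ p) \<in> K" using assms(1,6) by (auto simp: extendable_def)
  then have "s ^ p \<in> K"
    using assms(1,6) by (auto simp: s_def extendable_def power_mult_distrib intro: complex_subfield.mult)
  moreover have "s \<in> \<real>" by (simp add: s_def complex_norm_square[symmetric])
  ultimately obtain K\<^sub>1 where K\<^sub>1: "extendable K\<^sub>1" "K \<subseteq> K\<^sub>1" "s \<in> K\<^sub>1"
    using extendable_adj[OF assms(1) step[OF assms(1,3)], of s] assms(1) by (cases "s \<in> K") auto
  show ?thesis
  proof (cases "a \<in> K\<^sub>1")
    case False
    then have "\<exists>K'. extendable K' \<and> K\<^sub>1 \<subseteq> K' \<and> a \<in> K'"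
      using extendable_adj[OF K\<^sub>1(1) step[OF K\<^sub>1(1)], of a] K\<^sub>1 assms by (auto simp: s_def)
    then show ?thesis using K\<^sub>1 by blast
  qed (use K\<^sub>1 in blast)
qed

definition adjoinable :: "complex set" where
  "adjoinable = {z. \<forall>K. extendable K \<longrightarrow> (\<exists>K'. extendable K' \<and> K \<subseteq> K' \<and> z \<in> K')}"

text \<open>Adjoin x to K and then y to the result, which is possible because
  \<open>adjoinable\<close> quantifies over all extendable fields.\<close>

lemma adjoinable2:
  assumes "x \<in> adjoinable" "y \<in> adjoinable" "extendable K"
  obtains K' where "extendable K'" "K \<subseteq> K'" "x \<in> K'" "y \<in> K'"
  using assms unfolding adjoinable_def by blast

lemma extendable_Rats: "extendable \<rat>"
  unfolding extendable_def
proof (intro conjI irr)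
  show "complex_subfield \<rat>" by unfold_locales auto
  show "cnj ` \<rat> \<subseteq> \<rat>" by (auto simp: cnj_Rats)
qed

lemma adjoinable_closed: "prime_radical_closed adjoinable"
proof
  show "1 \<in> adjoinable"
    by (auto simp: adjoinable_def extendable_def dest: complex_subfield.one)
  show "x - y \<in> adjoinable" if "x \<in> adjoinable" "y \<in> adjoinable" for x y
    unfolding adjoinable_def mem_Collect_eq
    by (metis adjoinable2[OF that] complex_subfield.diff extendable_def)
  show "x * y \<in> adjoinable" if "x \<in> adjoinable" "y \<in> adjoinable" for x y
    unfolding adjoinable_def mem_Collect_eq
    by (metis adjoinable2[OF that] complex_subfield.mult extendable_def)
  show "inverse x \<in> adjoinable" if "x \<in> adjoinable" for x
    unfolding adjoinable_def mem_Collect_eq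
    by (metis adjoinable2[OF that that] complex_subfield.inverse extendable_def)
  show "a \<in> adjoinable"
    if prems: "prime p" "\<zeta> \<in> adjoinable" "\<zeta> ^ p = 1" "\<zeta> \<noteq> 1" "a ^ p \<in> adjoinable" for p \<zeta> a
    unfolding adjoinable_def mem_Collect_eq
  proof (intro allI impI)
    fix K assume "extendable K"
    then obtain K\<^sub>1 where "extendable K\<^sub>1" "K \<subseteq> K\<^sub>1" "\<zeta> \<in> K\<^sub>1" "a ^ p \<in> K\<^sub>1"
      using adjoinable2[OF prems(2,5)] by blast
    then show "\<exists>K'. extendable K' \<and> K \<subseteq> K' \<and> a \<in> K'"
      using extendable_prime_root[of K\<^sub>1 p \<zeta> a] prems by blast
  qed
qed

theorem root_not_radical:
  assumes "poly f z = 0"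
  shows "z \<notin> radical_numbers"
proof
  assume "z \<in> radical_numbers"
  then have "z \<in> adjoinable"
    using prime_radical_closed.radical_numbers_subset[OF adjoinable_closed] by blast
  then obtain K where K: "extendable K" "z \<in> K"
    using extendable_Rats unfolding adjoinable_def by blast
  then interpret complex_subfield K by (simp add: extendable_def)
  have "[:- z, 1:] \<in> polys_over K"
    using K(2) one zero minus by (auto simp: polys_over_def coeff_pCons split: nat.split)
  then have "degree f \<le> degree [:- z, 1:]"
    using K(1) assms unfolding extendable_def roots_full_degree_def by fastforce
  then show False using prime_gt_1_nat[OF deg(1)] by simp
qed

end

section \<open>The quintic\<close>

definition quintic :: "complex poly" where
  "quintic = [:-2, 7, 0, -5, 0, 1:]"

lemma poly_quintic: "poly quintic z = z ^ 5 - 5 * z ^ 3 + 7 * z - 2"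
  by (simp add: quintic_def eval_nat_numeral algebra_simps)

lemma degree_quintic: "degree quintic = 5" and lead_coeff_quintic: "lead_coeff quintic = 1"
  by (simp_all add: quintic_def)

lemma quintic_over_Rats: "quintic \<in> polys_over \<rat>"
  by (auto simp: polys_over_def quintic_def coeff_pCons split: nat.split)

section \<open>Gauss's lemma and irreducibility of the quintic\<close>

lemma rat_poly_clear_denominators:
  assumes "P \<in> polys_over \<rat>"
  obtains m :: int and A :: "int poly" where "m > 0" "smult (of_int m) P = map_poly of_int A"
proof -
  have "\<forall>i. \<exists>a b. b > (0::int) \<and> coeff P i = of_int a / of_int b"
    using assms unfolding polys_over_def by (metis (mono_tags, lifting) Rats_cases' mem_Collect_eq)
  then obtain a b where ab: "\<And>i. b i > (0::int)" "\<And>i. coeff P i = of_int (a i) / of_int (b i)" by metis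
  define m where "m = (\<Prod>i\<le>degree P. b i)"
  have m: "m > 0" unfolding m_def by (intro prod_pos) (simp add: ab)
  define A where "A = Poly (map (\<lambda>i. a i * (m div b i)) [0..<Suc (degree P)])"
  have "smult (of_int m) P = map_poly of_int A"
  proof (rule poly_eqI)
    fix i
    show "coeff (smult (of_int m) P) i = coeff (map_poly of_int A) i"
    proof (cases "i \<le> degree P")
      case True
      have "b i dvd m" unfolding m_def using True by (intro dvd_prodI) auto
      then obtain k where "m = b i * k" by (elim dvdE)
      then have "of_int (m div b i) = (of_int m / of_int (b i) :: complex)"
        using ab(1)[of i] by simp
      then show ?thesis using True
        by (simp add: A_def coeff_map_poly nth_default_def ab(2) del: upt_Suc)
    next
      case False
      then show ?thesis by (simp add: A_def coeff_map_poly nth_default_def coeff_eq_0 del: upt_Suc)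
    qed
  qed
  then show ?thesis using that m by blast
qed

lemma map_poly_of_int_mult:
  "map_poly of_int (A * B) = (map_poly of_int A * map_poly of_int B :: complex poly)"
  by (rule poly_eqI) (simp add: coeff_map_poly coeff_mult)

lemma map_poly_of_int_smult:
  "map_poly of_int (smult c A) = smult (of_int c) (map_poly of_int A :: complex poly)"
  by (rule poly_eqI) (simp add: coeff_map_poly)

lemma map_poly_of_int_eq_iff:
  "map_poly of_int A = (map_poly of_int B :: complex poly) \<longleftrightarrow> A = B"
  by (auto simp: poly_eq_iff coeff_map_poly)

lemma degree_map_poly_of_int: "degree (map_poly of_int A :: complex poly) = degree A"
  by (rule degree_map_poly) auto

text \<open>After clearing denominators, contents multiply and F is primitive, so the primitive
  parts already multiply to F. Their leading coefficients are both 1 or both -1, and a common sign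
  change handles the latter.\<close>

lemma gauss_monic_factorization:
  fixes F :: "int poly" and P Q :: "complex poly"
  assumes F: "map_poly of_int F = P * Q" "lead_coeff F = 1"
    and P: "P \<in> polys_over \<rat>" and Q: "Q \<in> polys_over \<rat>"
  obtains A B where "F = A * B" "degree A = degree P" "degree B = degree Q"
    "lead_coeff A = 1" "lead_coeff B = 1"
proof -
  obtain m A where mA: "m > 0" "smult (of_int m) P = map_poly of_int A"
    using rat_poly_clear_denominators[OF P] .
  obtain n B where nB: "n > 0" "smult (of_int n) Q = map_poly of_int B"
    using rat_poly_clear_denominators[OF Q] .
  have "map_poly of_int (smult (m * n) F) = (map_poly of_int (A * B) :: complex poly)"
    by (simp add: map_poly_of_int_mult map_poly_of_int_smult F(1) mult_ac flip: mA(2) nB(2))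
  then have eq: "smult (m * n) F = A * B" by (simp only: map_poly_of_int_eq_iff)
  have F0: "F \<noteq> 0" using F(2) by auto
  have "is_unit (content F)" using content_dvd_coeff[of F "degree F"] F(2) by simp
  then have cF: "content F = 1" by (metis normalize_content is_unit_normalize)
  define A' B' where "A' = primitive_part A" and "B' = primitive_part B"
  have "content A * content B = m * n"
    using arg_cong[OF eq, of content] mA nB cF by (simp add: content_mult)
  then have "smult (m * n) F = smult (m * n) (A' * B')"
    unfolding eq by (metis A'_def B'_def content_times_primitive_part mult_smult_left mult_smult_right smult_smult)
  then have FAB: "F = A' * B'" using mA(1) nB(1) by (simp add: poly_eq_iff)
  have dA: "degree A' = degree P"
  proof -
    have "degree (map_poly of_int A :: complex poly) = degree P" unfolding mA(2)[symmetric] using mA(1) by simp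
    then show ?thesis by (simp add: A'_def degree_map_poly_of_int degree_primitive_part)
  qed
  have dB: "degree B' = degree Q"
  proof -
    have "degree (map_poly of_int B :: complex poly) = degree Q" unfolding nB(2)[symmetric] using nB(1) by simp
    then show ?thesis by (simp add: B'_def degree_map_poly_of_int degree_primitive_part)
  qed
  have "lead_coeff A' * lead_coeff B' = 1" using F(2) unfolding FAB lead_coeff_mult .
  then have "lead_coeff A' = 1 \<and> lead_coeff B' = 1 \<or> lead_coeff A' = - 1 \<and> lead_coeff B' = - 1"
    by (simp add: zmult_eq_1_iff)
  then show ?thesis
  proof
    assume "lead_coeff A' = 1 \<and> lead_coeff B' = 1"
    then show ?thesis using that[of A' B'] FAB dA dB by simp
  next
    assume "lead_coeff A' = - 1 \<and> lead_coeff B' = - 1"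
    then show ?thesis using that[of "- A'" "- B'"] FAB dA dB by simp
  qed
qed

lemma quintic_no_integer_root: "(r::int) ^ 5 - 5 * r ^ 3 + 7 * r - 2 \<noteq> 0"
proof
  assume "r ^ 5 - 5 * r ^ 3 + 7 * r - 2 = 0"
  then have "r * (r ^ 4 - 5 * r ^ 2 + 7) = 2" by (simp add: eval_nat_numeral algebra_simps)
  then have "r dvd 2" by (metis dvd_triv_left)
  then have "\<bar>r\<bar> \<le> 2" using zdvd_imp_le[of "\<bar>r\<bar>" 2] by simp
  then have "r \<in> {-2, -1, 0, 1, 2}" by auto
  then show False using \<open>r ^ 5 - 5 * r ^ 3 + 7 * r - 2 = 0\<close> by auto
qed

text \<open>The coefficient equations of (X^2 + a X + b)(X^3 + c X^2 + d X + e). Eliminating c, d, e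
  shows that a divides e, so a and b both divide 2 and few cases remain.\<close>

lemma quintic_no_quadratic_factor:
  fixes a b c d e :: int
  assumes "c + a = 0" "d + a * c + b = - 5" "e + a * d + b * c = 0" "a * e + b * d = 7" "b * e = - 2"
  shows False
proof -
  have c: "c = - a" using assms(1) by simp
  have d: "d = a * a - b - 5" using assms(2) unfolding c by simp
  have e: "e = a * (2 * b + 5 - a * a)" using assms(3) by (simp add: c d algebra_simps)
  have small: "k \<in> {-2, -1, 1, 2}" if "k dvd (2::int)" for k
    using that zdvd_imp_le[of "\<bar>k\<bar>" 2] by (cases "k = 0") auto
  have "b dvd 2" using assms(5) by (metis dvd_minus_iff dvd_triv_left)
  moreover have "a dvd 2" using assms(5) e by (metis dvd_minus_iff dvd_triv_left dvd_trans dvd_triv_right mult.left_commute)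
  ultimately have "b \<in> {-2, -1, 1, 2}" "a \<in> {-2, -1, 1, 2}" using small by blast+
  then show False using assms(4,5) unfolding d e by auto
qed

lemma monic_poly_eq_Poly:
  assumes "lead_coeff P = (1::int)" "degree P = n"
  shows "P = Poly (map (coeff P) [0..<n] @ [1])"
  using assms by (intro poly_eqI) (auto simp: nth_default_def nth_append coeff_eq_0 not_less le_less)

text \<open>A minimal polynomial of degree below 5 would yield a monic integer factorization of type
  1 + 4 or 2 + 3.\<close>

lemma quintic_irreducible: "roots_full_degree \<rat> quintic"
  unfolding roots_full_degree_def degree_quintic
proof (intro allI impI, rule ccontr)
  fix P z
  assume P: "P \<in> polys_over \<rat>" "P \<noteq> 0" "poly quintic z = 0" "poly P z = 0" "\<not> 5 \<le> degree P"
  interpret complex_subfield \<rat> by unfold_locales auto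
  define S where "S = {P. P \<in> polys_over \<rat> \<and> P \<noteq> 0 \<and> poly P z = 0}"
  have "P \<in> S" using P by (simp add: S_def)
  then obtain h where h: "h \<in> S" "\<And>Q. Q \<in> S \<Longrightarrow> degree h \<le> degree Q"
    using ex_has_least_nat[of "\<lambda>P. P \<in> S" P degree] by blast
  obtain q where q: "q \<in> polys_over \<rat>" "quintic = q * h"
    using minimal_poly_dvd[of h z quintic] h P(3) quintic_over_Rats by (auto simp: S_def)
  define F :: "int poly" where "F = [:-2, 7, 0, -5, 0, 1:]"
  have F: "map_poly of_int F = quintic" by (simp add: F_def quintic_def map_poly_pCons)
  obtain A B where AB: "F = A * B" "degree A = degree q" "degree B = degree h" "lead_coeff A = 1" "lead_coeff B = 1"
    using gauss_monic_factorization[of F q h] F q h(1) by (auto simp: F_def S_def)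
  have dF: "degree F = 5" by (simp add: F_def)
  have AB0: "A \<noteq> 0" "B \<noteq> 0" using AB by auto
  have deg: "degree A + degree B = 5" using dF AB0 unfolding AB(1) by (simp add: degree_mult_eq)
  have dB: "degree B < 5" using h(2)[OF \<open>P \<in> S\<close>] P(5) AB(3) by simp
  have "degree B \<noteq> 0"
  proof
    assume "degree B = 0"
    then obtain k where "h = [:k:]" using AB(3) by (metis degree_eq_zeroE)
    then show False using h(1) by (auto simp: S_def)
  qed
  have linear: False if UV: "F = U * V" "degree U = 1" "lead_coeff U = 1" for U V
  proof -
    obtain k where "U = [:k, 1:]" using monic_poly_eq_Poly[OF UV(3,2)] by simp
    then have "poly F (- k) = 0" using UV(1) by simp
    then show False using quintic_no_integer_root[of "- k"] by (simp add: F_def eval_nat_numeral algebra_simps)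
  qed
  have quadratic: False if UV: "F = U * V" "degree U = 2" "degree V = 3" "lead_coeff U = 1" "lead_coeff V = 1" for U V
  proof -
    have U: "U = [:coeff U 0, coeff U 1, 1:]" using monic_poly_eq_Poly[OF UV(4,2)] by (simp add: upt_rec)
    have V: "V = [:coeff V 0, coeff V 1, coeff V 2, 1:]"
      using monic_poly_eq_Poly[OF UV(5,3)] by (simp add: upt_rec eval_nat_numeral)
    obtain a b c d e where "U = [:b, a, 1:]" "V = [:e, d, c, 1:]" using U V by blast
    then have "F = [:b * e, a * e + b * d, e + a * d + b * c, d + a * c + b, c + a, 1:]"
      using UV(1) by (simp add: algebra_simps)
    then show False using quintic_no_quadratic_factor[of c a d b e] by (simp add: F_def)
  qed
  consider "degree B = 1" | "degree B = 2" "degree A = 3" | "degree B = 3" "degree A = 2" | "degree A = 1"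
    using deg dB \<open>degree B \<noteq> 0\<close> by linarith
  then show False
  proof cases
    case 1 then show ?thesis using linear[of B A] AB by (simp add: mult.commute)
  next
    case 2 then show ?thesis using quadratic[of B A] AB by (simp add: mult.commute)
  next
    case 3 then show ?thesis using quadratic[of A B] AB by simp
  next
    case 4 then show ?thesis using linear[of A B] AB by simp
  qed
qed

lemma quintic_real_root_between:
  fixes a b :: real
  assumes "a \<le> b" "a ^ 5 - 5 * a ^ 3 + 7 * a - 2 \<le> 0" "b ^ 5 - 5 * b ^ 3 + 7 * b - 2 \<ge> 0"
  obtains x where "a \<le> x" "x \<le> b" "x ^ 5 - 5 * x ^ 3 + 7 * x - 2 = 0"
proof -
  have "\<exists>x. a \<le> x \<and> x \<le> b \<and> x ^ 5 - 5 * x ^ 3 + 7 * x - 2 = 0"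
    by (rule IVT') (use assms in \<open>auto intro!: continuous_intros\<close>)
  then show ?thesis using that by blast
qed

text \<open>The equation reads x * (x^4 - 5 x^2 + 7) = 2, and completing the square in x^2 shows
  that the second factor is positive.\<close>

lemma quintic_real_root_pos:
  fixes x :: real
  assumes "x ^ 5 - 5 * x ^ 3 + 7 * x - 2 = 0"
  shows "x > 0"
proof -
  have "x ^ 4 - 5 * x\<^sup>2 + 7 = (x\<^sup>2 - 5 / 2)\<^sup>2 + 3 / 4"
    by (simp add: power2_eq_square eval_nat_numeral algebra_simps)
  then have "x ^ 4 - 5 * x\<^sup>2 + 7 > 0" by (metis add_nonneg_pos zero_le_power2 zero_less_divide_iff zero_less_numeral)
  moreover have "x * (x ^ 4 - 5 * x\<^sup>2 + 7) = 2"
    using assms by (simp add: power2_eq_square eval_nat_numeral algebra_simps)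
  ultimately show ?thesis by (metis zero_less_mult_pos2 zero_less_numeral)
qed

text \<open>All real roots are positive, whereas the five roots sum to zero.\<close>

lemma quintic_nonreal_root:
  obtains w where "poly quintic w = 0" "w \<notin> \<real>"
proof -
  have "\<exists>w. poly quintic w = 0 \<and> w \<notin> \<real>"
  proof (rule ccontr)
    assume "\<not> ?thesis"
    then have real: "Im w = 0" if "poly quintic w = 0" for w using that by (auto simp: complex_is_Real_iff)
    have pos: "Re w > 0" if "poly quintic w = 0" for w
    proof -
      have "w = of_real (Re w)" using real[OF that] by (simp add: complex_eq_iff)
      then have "of_real (Re w ^ 5 - 5 * Re w ^ 3 + 7 * Re w - 2) = (0 :: complex)"
        using that unfolding poly_quintic by (metis (no_types, lifting) of_real_diff of_real_add of_real_mult of_real_numeral of_real_power)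
      then show ?thesis using quintic_real_root_pos by (metis of_real_eq_0_iff)
    qed
    have split: "\<exists>w R. P = [:- w, 1:] * R \<and> degree R = n" if "degree P = Suc n" for P :: "complex poly" and n
    proof -
      have "\<not> constant (poly P)" using that by (simp add: constant_degree)
      then obtain w where "poly P w = 0" using fundamental_theorem_of_algebra by blast
      then obtain R where R: "P = [:- w, 1:] * R" by (metis dvdE poly_eq_0_iff_dvd)
      have "P \<noteq> 0" using that by auto
      then have "R \<noteq> 0" using R by auto
      then have "degree P = Suc (degree R)" unfolding R by (subst degree_mult_eq) auto
      then show ?thesis using R that by auto
    qed
    obtain w1 R1 where 1: "quintic = [:- w1, 1:] * R1" "degree R1 = 4" using split[of quintic 4] by (auto simp: degree_quintic)
    obtain w2 R2 where 2: "R1 = [:- w2, 1:] * R2" "degree R2 = 3" using split[of R1 3] 1 by auto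
    obtain w3 R3 where 3: "R2 = [:- w3, 1:] * R3" "degree R3 = 2" using split[of R2 2] 2 by auto
    obtain w4 R4 where 4: "R3 = [:- w4, 1:] * R4" "degree R4 = 1" using split[of R3 1] 3 by auto
    obtain w5 R5 where 5: "R4 = [:- w5, 1:] * R5" "degree R5 = 0" using split[of R4 0] 4 by auto
    obtain k where k: "R5 = [:k:]" using 5(2) by (metis degree_eq_zeroE)
    have q: "quintic = [:- w1, 1:] * [:- w2, 1:] * [:- w3, 1:] * [:- w4, 1:] * [:- w5, 1:] * [:k:]"
      by (simp only: 1(1) 2(1) 3(1) 4(1) 5(1) k mult.assoc)
    have "coeff quintic 5 = k" unfolding q by (simp add: eval_nat_numeral)
    then have "k = 1" by (simp add: quintic_def eval_nat_numeral)
    have "coeff quintic 4 = - (w1 + w2 + w3 + w4 + w5)"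
      unfolding q \<open>k = 1\<close> by (simp add: eval_nat_numeral algebra_simps)
    moreover have "coeff quintic 4 = 0" by (simp add: quintic_def eval_nat_numeral)
    ultimately have sum0: "w1 + w2 + w3 + w4 + w5 = 0" by (metis neg_equal_0_iff_equal)
    have "poly quintic w1 = 0" "poly quintic w2 = 0" "poly quintic w3 = 0" "poly quintic w4 = 0" "poly quintic w5 = 0"
      by (simp_all only: q poly_mult) simp_all
    then have "Re (w1 + w2 + w3 + w4 + w5) > 0" using pos by (simp add: add_pos_pos)
    then show False unfolding sum0 by simp
  qed
  then show ?thesis using that by blast
qed

lemma quintic_root_not_radical:
  assumes "poly quintic z = 0"
  shows "z \<notin> radical_numbers"
proof -
  \<comment> \<open>The quintic takes the values -2, 1, -25/32 and 4 at 0, 1, 3/2 and 2.\<close>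
  obtain x\<^sub>1 where x1: "0 \<le> x\<^sub>1" "x\<^sub>1 \<le> 1" "x\<^sub>1 ^ 5 - 5 * x\<^sub>1 ^ 3 + 7 * x\<^sub>1 - 2 = (0::real)"
    using quintic_real_root_between[of 0 1] by auto
  obtain x\<^sub>2 where x2: "3 / 2 \<le> x\<^sub>2" "x\<^sub>2 \<le> 2" "x\<^sub>2 ^ 5 - 5 * x\<^sub>2 ^ 3 + 7 * x\<^sub>2 - 2 = (0::real)"
    using quintic_real_root_between[of "3 / 2" 2] by (auto simp: eval_nat_numeral)
  obtain w where w: "poly quintic w = 0" "w \<notin> \<real>" by (rule quintic_nonreal_root)
  have real: "poly quintic (of_real x) = 0" if "x ^ 5 - 5 * x ^ 3 + 7 * x - 2 = 0" for x :: real
  proof -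
    have "poly quintic (of_real x) = of_real (x ^ 5 - 5 * x ^ 3 + 7 * x - 2)" by (simp add: poly_quintic)
    then show ?thesis using that by simp
  qed
  interpret kronecker_poly quintic "of_real x\<^sub>1" "of_real x\<^sub>2" w
    by unfold_locales
       (use quintic_over_Rats lead_coeff_quintic degree_quintic quintic_irreducible real x1 x2 w in auto)
  show ?thesis using root_not_radical assms .
qed

section \<open>Circles tangent to a common circle\<close>

text \<open>The common external tangent length, scaled to 1 for tangent circles. In the Lorentz
  encoding of the existence proof circles are unit vectors, and this is half the Lorentz length of
  their difference, hence Moebius invariant.\<close>

definition half_chord :: "(nat \<Rightarrow> complex) \<Rightarrow> (nat \<Rightarrow> real) \<Rightarrow> nat \<Rightarrow> nat \<Rightarrow> real" where
  "half_chord c r i j = sqrt (((cmod (c i - c j))\<^sup>2 - (r i - r j)\<^sup>2) / (4 * r i * r j))"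

lemma half_chord_commute: "half_chord c r i j = half_chord c r j i"
  by (simp add: half_chord_def norm_minus_commute power2_commute mult_ac)

text \<open>Which product is the sum depends on the cyclic order of the tangency points, which is
  left open.\<close>

definition ptolemy :: "real \<Rightarrow> real \<Rightarrow> real \<Rightarrow> bool" where
  "ptolemy P Q R \<longleftrightarrow> P = Q + R \<or> Q = P + R \<or> R = P + Q"

text \<open>In polar angles \<theta> about the common circle, the law of cosines turns each half
  chord into |W u W v sin ((\<theta> u - \<theta> v) / 2)|.\<close>

lemma casey:
  assumes r: "r a > 0" "\<And>v. v \<in> {i, j, k, l} \<Longrightarrow> r v > 0"
    and tan: "\<And>v. v \<in> {i, j, k, l} \<Longrightarrow> cmod (c v - c a) = r v + r a"
  shows "ptolemy (half_chord c r i j * half_chord c r k l) (half_chord c r i k * half_chord c r j l)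
    (half_chord c r i l * half_chord c r j k)"
proof -
  define \<theta> where "\<theta> v = Arg (c v - c a)" for v
  define W where "W v = sqrt ((r v + r a) / r v)" for v
  define D where "D u v = W u * W v * sin ((\<theta> u - \<theta> v) / 2)" for u v
  have cv: "c v = c a + of_real (r v + r a) * cis (\<theta> v)" if "v \<in> {i, j, k, l}" for v
  proof -
    have "c v - c a = of_real (cmod (c v - c a)) * cis (Arg (c v - c a))"
      by (metis rcis_cmod_Arg rcis_def)
    then show ?thesis using tan[OF that] by (simp add: \<theta>_def algebra_simps)
  qed
  have chord: "half_chord c r u v = \<bar>D u v\<bar>" if uv: "u \<in> {i, j, k, l}" "v \<in> {i, j, k, l}" for u v
  proof -
    define \<alpha> where "\<alpha> = (\<theta> u - \<theta> v) / 2"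
    have ru: "r u > 0" "r v > 0" "r u + r a > 0" "r v + r a > 0" using r uv by (auto intro: add_pos_pos)
    have cosd: "cos (\<theta> u) * cos (\<theta> v) + sin (\<theta> u) * sin (\<theta> v) = 1 - 2 * (sin \<alpha>)\<^sup>2"
    proof -
      have "\<theta> u - \<theta> v = 2 * \<alpha>" by (simp add: \<alpha>_def)
      then show ?thesis by (metis cos_diff cos_double_sin)
    qed
    have expand: "(A * x - B * y)\<^sup>2 + (A * z - B * t)\<^sup>2
        = A\<^sup>2 * (z\<^sup>2 + x\<^sup>2) + B\<^sup>2 * (t\<^sup>2 + y\<^sup>2) - 2 * A * B * (x * y + z * t)" for A B x y z t :: real
      by (simp add: power2_eq_square algebra_simps)
    have "(cmod (c u - c v))\<^sup>2 = ((r u + r a) * cos (\<theta> u) - (r v + r a) * cos (\<theta> v))\<^sup>2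
        + ((r u + r a) * sin (\<theta> u) - (r v + r a) * sin (\<theta> v))\<^sup>2"
      unfolding cv[OF uv(1)] cv[OF uv(2)] by (simp add: cmod_power2)
    also have "\<dots> = (r u + r a)\<^sup>2 * ((sin (\<theta> u))\<^sup>2 + (cos (\<theta> u))\<^sup>2)
        + (r v + r a)\<^sup>2 * ((sin (\<theta> v))\<^sup>2 + (cos (\<theta> v))\<^sup>2)
        - 2 * (r u + r a) * (r v + r a) * (cos (\<theta> u) * cos (\<theta> v) + sin (\<theta> u) * sin (\<theta> v))"
      by (rule expand)
    also have "\<dots> = (r u + r a)\<^sup>2 + (r v + r a)\<^sup>2 - 2 * (r u + r a) * (r v + r a) * (1 - 2 * (sin \<alpha>)\<^sup>2)"
      unfolding cosd by simp
    finally have "(cmod (c u - c v))\<^sup>2 - (r u - r v)\<^sup>2 = 4 * (r u + r a) * (r v + r a) * (sin \<alpha>)\<^sup>2"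
      by (simp add: power2_eq_square algebra_simps)
    then have "half_chord c r u v = sqrt (((r u + r a) / r u) * ((r v + r a) / r v) * (sin \<alpha>)\<^sup>2)"
      unfolding half_chord_def using ru by (simp add: field_simps)
    also have "\<dots> = W u * W v * \<bar>sin \<alpha>\<bar>"
      by (simp only: W_def real_sqrt_mult real_sqrt_abs)
    also have "\<dots> = \<bar>D u v\<bar>"
      using ru by (simp add: D_def \<alpha>_def abs_mult W_def)
    finally show ?thesis .
  qed
  \<comment> \<open>The three-term identity for sines of half differences holds with signs; taking
    absolute values is what leaves three alternatives.\<close>
  have plucker: "D i j * D k l - D i k * D j l + D i l * D j k = 0"
  proof -
    have "sin ((x - y) / 2) * sin ((z - t) / 2) - sin ((x - z) / 2) * sin ((y - t) / 2)
        + sin ((x - t) / 2) * sin ((y - z) / 2) = 0" for x y z t :: real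
      unfolding diff_divide_distrib sin_diff by (simp add: algebra_simps)
    then have "W i * W j * W k * W l * (sin ((\<theta> i - \<theta> j) / 2) * sin ((\<theta> k - \<theta> l) / 2)
        - sin ((\<theta> i - \<theta> k) / 2) * sin ((\<theta> j - \<theta> l) / 2)
        + sin ((\<theta> i - \<theta> l) / 2) * sin ((\<theta> j - \<theta> k) / 2)) = 0" by simp
    then show ?thesis by (simp add: D_def algebra_simps)
  qed
  have abs3: "ptolemy \<bar>P\<bar> \<bar>Q\<bar> \<bar>R\<bar>" if "P - Q + R = 0" for P Q R :: real
    using that unfolding ptolemy_def by linarith
  show ?thesis using abs3[OF plucker] chord by (simp add: abs_mult)
qed

lemma half_chord_ge_1:
  assumes "r i > 0" "r j > 0" "cmod (c i - c j) \<ge> r i + r j"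
  shows "half_chord c r i j \<ge> 1"
proof -
  have "(cmod (c i - c j))\<^sup>2 \<ge> (r i + r j)\<^sup>2" using assms by (intro power_mono) auto
  then have "((cmod (c i - c j))\<^sup>2 - (r i - r j)\<^sup>2) / (4 * r i * r j) \<ge> 1"
    using assms by (simp add: field_simps power2_eq_square)
  then show ?thesis by (simp add: half_chord_def)
qed

lemma half_chord_eq_1:
  assumes "r i > 0" "r j > 0" "cmod (c i - c j) = r i + r j"
  shows "half_chord c r i j = 1"
proof -
  have "((cmod (c i - c j))\<^sup>2 - (r i - r j)\<^sup>2) / (4 * r i * r j) = 1"
    unfolding assms(3) using assms by (simp add: field_simps power2_eq_square)
  then show ?thesis by (simp only: half_chord_def real_sqrt_one)
qed

section \<open>Resolving the signs in Ptolemy's relations by lower bounds\<close>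

lemma ptolemy_unit_square:
  assumes "ptolemy (1 * 1) (u * v) (1 * 1)" "u \<ge> 1" "v \<ge> (1::real)"
  shows "u * v = 2"
proof -
  have "u * v \<ge> 1" using mult_mono[of 1 u 1 v] assms by simp
  then show ?thesis using assms(1) by (auto simp: ptolemy_def)
qed

text \<open>a, ..., e are the diagonals of a ring of five circles, consecutive ones tangent, around
  a common circle. The only competing sign, d = 1 + a b, forces b = c = e = 1 and contradicts the
  second relation.\<close>

lemma ptolemy_pentagon:
  fixes a b c d e :: real
  assumes ge: "a \<ge> 1" "b \<ge> 1" "c \<ge> 1" "d \<ge> 1" "e \<ge> 1"
    and pt: "ptolemy 1 (a * b) d" "ptolemy 1 (b * c) e" "ptolemy 1 (c * d) a" "ptolemy 1 (d * e) b"
  shows "a * b = 1 + d"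
proof (rule ccontr)
  assume ne: "a * b \<noteq> 1 + d"
  have mult_ge: "x * y \<ge> x" "y * x \<ge> x" if "x \<ge> 1" "y \<ge> 1" for x y :: real
    using mult_left_mono[of 1 y x] that by (auto simp: mult.commute)
  have d: "d = 1 + a * b" using pt(1) ne mult_ge[OF ge(1,2)] ge by (auto simp: ptolemy_def)
  have "c * d = 1 + a"
    using pt(3) mult_ge[OF ge(4,3)] mult_ge[OF ge(1,2)] ge d unfolding ptolemy_def by argo
  then have eq1: "c + (a * b) * c = 1 + a" by (simp add: d algebra_simps)
  have "d * e = 1 + b"
    using pt(4) mult_ge[OF ge(4,5)] mult_ge[OF ge(2,1)] ge d mult.commute[of a b] unfolding ptolemy_def by argo
  then have eq2: "e + (a * b) * e = 1 + b" by (simp add: d algebra_simps)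
  have ab: "a * b \<ge> a" "a * b \<ge> b" using mult_ge[OF ge(1,2)] mult_ge[OF ge(2,1)] by (auto simp: mult.commute)
  then have "a * b \<ge> 1" using ge by linarith
  then have "(a * b) * c \<ge> a * b" "(a * b) * e \<ge> a * b" using mult_ge ge by auto
  then have 1: "c = 1" "a * b = a" "e = 1" "a * b = b" using eq1 eq2 ge ab by linarith+
  then have "b = 1" using ge by simp
  then show False using pt(2) 1 by (auto simp: ptolemy_def)
qed

text \<open>In the gadget, y and c are the half chords of 6, 7 and of 8, 7; w,
  \<open>b\<^sub>2\<close>, \<open>b\<^sub>3\<close> those of cap 8 with 1, 2, 3; and z, z', s those
  of the chain pairs 0 3, 1 4, 0 4. The surviving signs give c (x - 1) = x^2 - 2.\<close>

lemma quintic_of_ptolemy: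
  fixes x y c w b\<^sub>2 b\<^sub>3 z z' s :: real
  assumes ge: "x \<ge> 1" "y \<ge> 1" "c \<ge> 1" "w \<ge> 1" "b\<^sub>2 \<ge> 1" "b\<^sub>3 \<ge> 1" "z \<ge> 1" "z' \<ge> 1" "s \<ge> 1"
    and xy: "x * y = 2" and c: "c\<^sup>2 = 1 + y" and w: "w * (c - 1) = 1"
    and b: "ptolemy 1 (w * x) b\<^sub>2" "ptolemy 1 (w * x) b\<^sub>3"
      "ptolemy w (b\<^sub>2 * x) b\<^sub>3" "ptolemy w (b\<^sub>3 * x) b\<^sub>2"
    and z: "ptolemy 1 (x * x) z" "ptolemy 1 (x * x) z'"
    and s: "ptolemy x (z * x) s" "ptolemy 1 (z * z') (s * x)"
    and bz: "ptolemy 1 (b\<^sub>2 * z) (b\<^sub>3 * x)" "ptolemy w (b\<^sub>3 * z') (w * x)"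
  shows "x ^ 5 - 5 * x ^ 3 + 7 * x - 2 = 0"
proof -
  \<comment> \<open>The degenerate point into which wrong sign choices collapse below.\<close>
  have x1: "x \<noteq> 1 \<or> w \<noteq> 2"
  proof (rule ccontr)
    assume "\<not> ?thesis"
    then have "y = 2" and c': "c = 3 / 2" using xy w by auto
    then show False using c unfolding c' by (simp add: power2_eq_square)
  qed
  have mult_ge: "u * v \<ge> u" "v * u \<ge> u" if "u \<ge> 1" "v \<ge> 1" for u v :: real
    using mult_left_mono[of 1 v u] that by (auto simp: mult.commute)
  have xx: "x * x \<ge> 1" using mult_ge[OF ge(1,1)] ge(1) by linarith
  note ges = ge mult_ge[OF ge(4,1)] mult_ge[OF ge(5,1)] mult_ge[OF ge(6,1)] mult_ge[OF ge(1,4)]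
    mult_ge[OF ge(1,1)] mult_ge[OF ge(1,7)] mult_ge[OF ge(7,1)] mult_ge[OF ge(1,9)]
  have B2: "b\<^sub>2 = w * x - 1 \<or> b\<^sub>2 = 1 + w * x" using b(1) ges unfolding ptolemy_def by argo
  have B3: "b\<^sub>3 = w * x - 1 \<or> b\<^sub>3 = 1 + w * x" using b(2) ges unfolding ptolemy_def by argo
  have mixed: False
    if "ptolemy w (u * x) v" "ptolemy w (v * x) u" "u = 1 + w * x" "v = w * x - 1" "v \<ge> 1" for u v
  proof -
    have u: "u * x \<ge> u" "v * x \<ge> v" using mult_ge[of u x] mult_ge[of v x] that ges by auto
    have "u * x = w + v" using that(1,3,4,5) u ges unfolding ptolemy_def by argo
    then have 1: "w * x * x + x = w + w * x - 1" using that by (simp add: algebra_simps)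
    have "v * x = w + u \<or> u = w + v * x" using that(2,3,4,5) u ges unfolding ptolemy_def by argo
    then have 2: "w * x * x - x = w + 1 + w * x \<or> 1 + w * x = w + w * x * x - x"
      using that by (auto simp: algebra_simps)
    have "1 + w * x = w + w * x * x - x" using 2 1 ges by linarith
    then have "w * x * x = w * x" using 1 by linarith
    then have "x = 1" using ges by simp
    then show False using 1 x1 by simp
  qed
  \<comment> \<open>Once \<open>mixed\<close> excludes different signs, the remaining wrong case
    \<open>b\<^sub>2 = b\<^sub>3 = 1 + w * x\<close> is refuted through the half chords z, z', s
    along the chain.\<close>
  have main: "b\<^sub>2 = w * x - 1 \<and> b\<^sub>3 = w * x - 1"
  proof (rule ccontr)
    assume "\<not> ?thesis"
    then have B: "b\<^sub>2 = 1 + w * x" "b\<^sub>3 = 1 + w * x" using B2 B3 mixed[of b\<^sub>2 b\<^sub>3] mixed[of b\<^sub>3 b\<^sub>2] b ges by auto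
    have "b\<^sub>2 * x = w + b\<^sub>3" using b(3) B ges unfolding ptolemy_def by argo
    then have key: "w * (x * x - x - 1) = 1 - x" by (simp add: B algebra_simps)
    have Z: "z = x * x - 1"
    proof (rule ccontr)
      assume "z \<noteq> x * x - 1"
      then have "z = x * x + 1" using z(1) ges unfolding ptolemy_def by argo
      then have "b\<^sub>2 * z = b\<^sub>2 * x + b\<^sub>2 * (x * x - x) + b\<^sub>2" by (simp add: algebra_simps)
      moreover have "b\<^sub>2 * (x * x - x) \<ge> 0" using ges by simp
      ultimately have "b\<^sub>2 * z \<ge> b\<^sub>3 * x + b\<^sub>2" by (simp add: B)
      then show False using bz(1) B ges unfolding ptolemy_def by argo
    qed
    have Z': "z' = x * x - 1"
    proof (rule ccontr)
      assume "z' \<noteq> x * x - 1"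
      then have "z' = x * x + 1" using z(2) ges unfolding ptolemy_def by argo
      then have "b\<^sub>3 * z' = b\<^sub>3 * (x * x) + b\<^sub>3" by (simp add: algebra_simps)
      moreover have "b\<^sub>3 * (x * x) \<ge> b\<^sub>3" using mult_ge[OF ge(6) xx] by simp
      ultimately have "b\<^sub>3 * z' \<ge> 2 + 2 * (w * x)" using B by simp
      then show False using bz(2) ges unfolding ptolemy_def by argo
    qed
    have "s = z * x - x \<or> s = z * x + x" using s(1) ges unfolding ptolemy_def by argo
    then show False
    proof
      assume "s = z * x - x"
      then have "s - 1 = (x * x - x - 1) * (x + 1)" by (simp add: Z algebra_simps)
      then have "x * x - x - 1 \<ge> 0" using ges by (smt (verit) mult_neg_pos)
      then have "w * (x * x - x - 1) \<ge> 0" using ges by simp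
      then have "x = 1" using key ges by simp
      then show False using key ges by simp
    next
      assume "s = z * x + x"
      then have sx: "s * x = (x * x)\<^sup>2" by (simp add: Z power2_eq_square algebra_simps)
      have zz: "z * z' = (x * x)\<^sup>2 - 2 * (x * x) + 1" by (simp add: Z Z' power2_eq_square algebra_simps)
      have "z * z' \<ge> 1" using mult_ge[OF ge(7,8)] ges by linarith
      then have "x * x = 1" using s(2) ges unfolding ptolemy_def sx zz by linarith
      then show False using Z ges by simp
    qed
  qed
  then have B: "b\<^sub>2 = w * x - 1" "b\<^sub>3 = w * x - 1" by auto
  have "b\<^sub>2 * x = w + b\<^sub>3"
  proof (rule ccontr)
    assume "b\<^sub>2 * x \<noteq> w + b\<^sub>3"
    then have 1: "w = b\<^sub>2 * x + b\<^sub>2" using b(3) B ges unfolding ptolemy_def by argo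
    then have "w * x = b\<^sub>2 * (x * x) + b\<^sub>2 * x" by (simp add: algebra_simps)
    moreover have "b\<^sub>2 * (x * x) \<ge> b\<^sub>2 * x" using mult_left_mono[of x "x * x" b\<^sub>2] ges by simp
    ultimately have "b\<^sub>2 * x = 1" "b\<^sub>2 = 1" using B ges by linarith+
    then show False using 1 x1 by simp
  qed
  then have "w * (x * x - x - 1) = x - 1" by (simp add: B algebra_simps)
  then have "(x - 1) * (c - 1) = (w * (c - 1)) * (x * x - x - 1)" by (simp add: mult_ac)
  then have "(x - 1) * (c - 1) = x * x - x - 1" unfolding w by simp
  then have "c * (x - 1) = x * x - 2" by (simp add: algebra_simps)
  \<comment> \<open>Squaring eliminates c by c^2 = 1 + y, and the factor x then eliminates y by x y
    = 2.\<close>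
  then have "x * (x * x - 2)\<^sup>2 = x * c\<^sup>2 * (x - 1)\<^sup>2" by (metis mult.assoc power_mult_distrib)
  also have "x * c\<^sup>2 = x + 2" using c xy by (simp add: algebra_simps)
  finally show ?thesis by (simp add: power2_eq_square eval_nat_numeral algebra_simps)
qed

text \<open>A chain 0 to 5 between two poles 6 and 7, closed up by two caps 8 and 9, each of which touches one
  pole and both ends of the chain.\<close>

definition gadget_edges :: "(nat \<times> nat) list" where
  "gadget_edges =
     [(0,1), (1,2), (2,3), (3,4), (4,5),
      (6,0), (6,1), (6,2), (6,3), (6,4), (6,5), (7,0), (7,1), (7,2), (7,3), (7,4), (7,5),
      (8,9), (8,6), (9,7), (8,0), (8,5), (9,0), (9,5)]"

definition gadget :: "nat \<Rightarrow> nat \<Rightarrow> bool" where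
  "gadget u v \<longleftrightarrow> (u, v) \<in> set gadget_edges \<or> (v, u) \<in> set gadget_edges"

text \<open>Around each vertex of degree four (1 to 4, 8, 9) opposite half chords multiply to 2. The
  vertices 0 and 5 have degree five and give pentagon relations; the other relations are taken
  around pole 6.\<close>

lemma gadget_quintic:
  assumes pack: "circle_packing n gadget c r" and n: "n \<ge> 10"
  defines "x \<equiv> half_chord c r 0 2"
  shows "x ^ 5 - 5 * x ^ 3 + 7 * x - 2 = 0"
proof -
  define L where "L = half_chord c r"
  have r: "r v > 0" if "v < 10" for v using pack that n by (auto simp: circle_packing_def)
  have sep: "cmod (c u - c v) \<ge> r u + r v" if "u < 10" "v < 10" "u \<noteq> v" for u v
    using pack that n by (auto simp: circle_packing_def)
  have tan: "cmod (c u - c v) = r u + r v" if "gadget u v" "u < 10" "v < 10" for u v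
    using pack that n by (auto simp: circle_packing_def)
  have ge: "L u v \<ge> 1" if "u < 10" "v < 10" "u \<noteq> v" for u v
    unfolding L_def using r sep that by (intro half_chord_ge_1) auto
  have eq: "L u v = 1" if "gadget u v" "u < 10" "v < 10" for u v
    unfolding L_def using r tan that by (intro half_chord_eq_1) auto
  have comm: "L u v = L v u" for u v by (simp add: L_def half_chord_commute)
  have casey: "ptolemy (L i j * L k l) (L i k * L j l) (L i l * L j k)"
    if "a < 10" "i < 10" "j < 10" "k < 10" "l < 10" "gadget i a" "gadget j a" "gadget k a" "gadget l a" for a i j k l
    unfolding L_def using r tan that by (intro casey[of r a]) auto
  note edge = gadget_def gadget_edges_def
  note simps = eq edge
  have deg4: "L i k * L j l = 2" if "a < 10" "i < 10" "j < 10" "k < 10" "l < 10"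
    "gadget i a" "gadget j a" "gadget k a" "gadget l a"
    "gadget i j" "gadget j k" "gadget k l" "gadget l i" "i \<noteq> k" "j \<noteq> l" for a i j k l
  proof -
    have "ptolemy (1 * 1) (L i k * L j l) (1 * 1)"
      using casey[OF that(1-9)]
      by (simp only: eq[OF that(10,2,3)] eq[OF that(11,3,4)] eq[OF that(12,4,5)] eq[OF that(13,5,2)] comm[of i l])
    then show ?thesis by (rule ptolemy_unit_square) (use ge that in auto)
  qed
  have q1: "L 0 2 * L 6 7 = 2" using deg4[of 1 0 6 2 7] by (simp add: edge)
  have q2: "L 1 3 * L 6 7 = 2" using deg4[of 2 1 6 3 7] by (simp add: edge)
  have q3: "L 2 4 * L 6 7 = 2" using deg4[of 3 2 6 4 7] by (simp add: edge)
  have q4: "L 3 5 * L 6 7 = 2" using deg4[of 4 3 6 5 7] by (simp add: edge)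
  have q8: "L 9 6 * L 0 5 = 2" using deg4[of 8 9 0 6 5] by (simp add: edge)
  have q9: "L 8 7 * L 0 5 = 2" using deg4[of 9 8 0 7 5] by (simp add: edge)
  have pos: "L 6 7 \<noteq> 0" "L 0 5 \<noteq> 0" using ge[of 6 7] ge[of 0 5] by auto
  have xs: "L 1 3 = L 0 2" "L 2 4 = L 0 2" "L 3 5 = L 0 2"
    using q1 q2 q3 q4 pos by (metis mult_cancel_right)+
  have cs: "L 9 6 = L 8 7" using q8 q9 pos by (metis mult_cancel_right)
  \<comment> \<open>Around a the neighbours are 8, 9, 7, m, 6 in cyclic order.\<close>
  have pentagon: "(L 8 7)\<^sup>2 = 1 + L 6 7 \<and> L 8 m * (L 8 7 - 1) = 1"
    if a: "(a, m) = (0, 1) \<or> (a, m) = (5, 4)" for a m :: nat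
  proof -
    have m: "m < 10" "a < 10" "m \<noteq> 8" "m \<noteq> 9" "m \<noteq> 6" "m \<noteq> 7" using a by auto
    have g: "gadget 8 a" "gadget 9 a" "gadget 7 a" "gadget m a" "gadget 6 a" "gadget 7 m" "gadget m 6"
      "gadget 8 9" "gadget 9 7" "gadget 6 8"
      using a by (auto simp: edge)
    have e: "L 8 9 = 1" "L 9 7 = 1" "L 7 m = 1" "L m 6 = 1" "L 6 8 = 1" using g eq m by auto
    have p1: "ptolemy 1 (L 8 7 * L 9 m) (L m 8)"
      using casey[of a 8 9 7 m] g m e by (simp add: comm[of m 8])
    have p2: "ptolemy 1 (L 9 m * L 6 7) (L 9 6)"
      using casey[of a 9 7 m 6] g m e by (simp add: comm[of 6 7])
    have p3: "ptolemy 1 (L 6 7 * L m 8) (L 8 7)"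
      using casey[of a 7 m 6 8] g m e by (simp add: comm[of 6 7] comm[of 8 7])
    have p4: "ptolemy 1 (L m 8 * L 9 6) (L 9 m)"
      using casey[of a m 6 8 9] g m e by (simp add: comm[of m 9] comm[of 6 9])
    have p5: "ptolemy 1 (L 9 6 * L 8 7) (L 6 7)"
      using casey[of a 6 8 9 7] g m e by (simp add: comm[of 6 9])
    have ges: "L 8 7 \<ge> 1" "L 9 m \<ge> 1" "L 6 7 \<ge> 1" "L m 8 \<ge> 1" "L 9 6 \<ge> 1" using ge m by auto
    have r1: "L 8 7 * L 9 m = 1 + L m 8"
      by (rule ptolemy_pentagon[OF ges p1 p2 p3 p4])
    have r2: "L 9 6 * L 8 7 = 1 + L 6 7"
      by (rule ptolemy_pentagon[OF ges(5,1,2,3,4) p5 p1 p2 p3])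
    have r3: "L m 8 * L 9 6 = 1 + L 9 m"
      by (rule ptolemy_pentagon[OF ges(4,5,1,2,3) p4 p5 p1 p2])
    \<comment> \<open>Because \<open>L 9 6 = L 8 7\<close>, the relations \<open>r1\<close> and
      \<open>r3\<close> are exchanged by swapping \<open>L m 8\<close> with \<open>L 9 m\<close>;
      subtracting them shows that the two are equal.\<close>
    have "(L 8 7 + 1) * (L m 8 - L 9 m) = 0" using r1 r3 by (simp add: cs algebra_simps)
    then have "L m 8 = L 9 m" using ges by simp
    then show ?thesis using r1 r2 by (simp add: cs comm[of 8 m] power2_eq_square algebra_simps)
  qed
  have p0: "(L 8 7)\<^sup>2 = 1 + L 6 7" "L 8 1 * (L 8 7 - 1) = 1" using pentagon[of 0 1] by auto
  have "L 8 4 * (L 8 7 - 1) = 1" using pentagon[of 5 4] by auto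
  then have w4: "L 8 4 = L 8 1" using p0(2) by (metis mult_cancel_right mult_zero_right zero_neq_one)
  \<comment> \<open>\<open>xs\<close> and \<open>w4\<close> express relations seen from either end
    of the chain in the same unknowns.\<close>
  have "ptolemy 1 (L 8 1 * L 0 2) (L 8 2)" using casey[of 6 8 0 1 2] by (simp add: simps del: One_nat_def)
  moreover have "ptolemy 1 (L 8 1 * L 0 2) (L 8 3)"
    using casey[of 6 8 5 4 3] by (simp add: simps w4 comm[of 5 3] xs del: One_nat_def)
  moreover have "ptolemy (L 8 1) (L 8 2 * L 0 2) (L 8 3)"
    using casey[of 6 8 1 2 3] by (simp add: simps xs del: One_nat_def)
  moreover have "ptolemy (L 8 1) (L 8 3 * L 0 2) (L 8 2)"
    using casey[of 6 8 4 3 2] by (simp add: simps w4 comm[of 4 2] xs del: One_nat_def)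
  moreover have "ptolemy 1 (L 0 2 * L 0 2) (L 0 3)"
    using casey[of 6 0 1 2 3] by (simp add: simps xs del: One_nat_def)
  moreover have "ptolemy 1 (L 0 2 * L 0 2) (L 1 4)"
    using casey[of 6 1 2 3 4] by (simp add: simps xs del: One_nat_def)
  moreover have "ptolemy (L 0 2) (L 0 3 * L 0 2) (L 0 4)"
    using casey[of 6 0 2 3 4] by (simp add: simps xs del: One_nat_def)
  moreover have "ptolemy 1 (L 0 3 * L 1 4) (L 0 4 * L 0 2)"
    using casey[of 6 0 1 3 4] by (simp add: simps xs del: One_nat_def)
  moreover have "ptolemy 1 (L 8 2 * L 0 3) (L 8 3 * L 0 2)"
    using casey[of 6 8 0 2 3] by (simp add: simps del: One_nat_def)
  moreover have "ptolemy (L 8 1) (L 8 3 * L 1 4) (L 8 1 * L 0 2)"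
    using casey[of 6 8 1 3 4] by (simp add: simps w4 xs del: One_nat_def)
  ultimately show ?thesis
    unfolding x_def L_def[symmetric]
    by (intro quintic_of_ptolemy[OF _ _ _ _ _ _ _ _ _ q1 p0]) (auto intro: ge)
qed

section \<open>Existence of a packing\<close>

lemma cos_le_cos_double:
  fixes h t :: real
  assumes "0 \<le> h" "2 * h \<le> t" "t \<le> 2 * pi - 2 * h"
  shows "cos t \<le> cos (2 * h)"
proof (cases "t \<le> pi")
  case True
  then show ?thesis using assms by (intro cos_monotone_0_pi_le) auto
next
  case False
  have "cos t = cos (2 * pi - t)" by simp
  also have "\<dots> \<le> cos (2 * h)" using assms False by (intro cos_monotone_0_pi_le) auto
  finally show ?thesis .
qed

text \<open>The Chebyshev polynomial of degree five; at x = 2 cos h the quintic equals 2 cos (5 h) +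
  2 x - 2.\<close>

lemma cos_5: "cos (5 * h) = 16 * cos h ^ 5 - 20 * cos h ^ 3 + 5 * cos (h :: real)"
proof -
  have "cos (5 * h) + cos h = 2 * cos (3 * h) * cos (2 * h)"
    using cos_plus_cos[of "5 * h" h] by simp
  then show ?thesis
    unfolding cos_treble_cos cos_double_cos by (simp add: eval_nat_numeral algebra_simps)
qed

text \<open>A circle of radius \<open>1/A\<close> with centre \<open>(B, D)/A\<close> is encoded by \<open>(A, B, D, C)\<close> with
  \<open>B\<^sup>2 + D\<^sup>2 - A C = 1\<close>. Tangency and disjointness become conditions on the Lorentz product
  polarizing this quadratic form.\<close>

lemma lorentz_circle_distance:
  fixes A B C D A' B' C' D' :: real
  assumes "A > 0" "A' > 0" "B\<^sup>2 + D\<^sup>2 = 1 + A * C" "B'\<^sup>2 + D'\<^sup>2 = 1 + A' * C'"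
  shows "(cmod (Complex (B / A) (D / A) - Complex (B' / A') (D' / A')))\<^sup>2
    = (1 / A + 1 / A')\<^sup>2 + 2 * (- 1 - (B * B' + D * D' - (A * C' + A' * C) / 2)) / (A * A')"
proof -
  have "(cmod (Complex (B / A) (D / A) - Complex (B' / A') (D' / A')))\<^sup>2
    = (B / A - B' / A')\<^sup>2 + (D / A - D' / A')\<^sup>2"
    by (simp add: cmod_power2)
  also have "\<dots> = (B\<^sup>2 + D\<^sup>2) / A\<^sup>2 + (B'\<^sup>2 + D'\<^sup>2) / A'\<^sup>2 - 2 * (B * B' + D * D') / (A * A')"
    using assms(1,2) by (simp add: power2_eq_square field_simps)
  also have "\<dots> = (1 / A + 1 / A')\<^sup>2 + 2 * (- 1 - (B * B' + D * D' - (A * C' + A' * C) / 2)) / (A * A')"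
    unfolding assms(3,4) using assms(1,2) by (simp add: power2_eq_square field_simps)
  finally show ?thesis .
qed

text \<open>In Minkowski coordinates \<open>(m, n, l; t)\<close> the two poles are \<open>(\<plusminus>y, 0, 0; \<tau>)\<close>, which makes the picture
  rotationally symmetric: the six circles tangent to both poles lie at angles \<open>(2k - 5) h\<close> with
  \<open>cos h = x/2\<close>, where \<open>x y = 2\<close>. The quintic for \<open>x\<close> says that both ends of the chain touch the two
  caps. The direction \<open>(5/13, 12/13, 0)\<close> is a rational unit vector for which all curvatures
  \<open>t - (5 m + 12 n)/13\<close> are positive.\<close>

lemma gadget_packing_exists:
  fixes x :: real
  assumes x: "x ^ 5 - 5 * x ^ 3 + 7 * x - 2 = 0" "44 / 25 \<le> x" "x \<le> 177 / 100"
  shows "\<exists>c r. circle_packing 10 gadget c r"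
proof -
  define y where "y = 2 / x"
  define \<tau> where "\<tau> = sqrt (y\<^sup>2 - 1)"
  \<comment> \<open>The caps will be (1, -g, 0; g) and (-1, -g, 0; g), of norm 1 for every g.
    Tangency to their poles, y - \<tau> g = -1, determines g.\<close>
  define g where "g = (1 + y) / \<tau>"
  define h where "h = arccos (x / 2)"
  define \<phi> where "\<phi> k = (2 * real k - 5) * h" for k
  have xy: "x * y = 2" using x by (simp add: y_def)
  \<comment> \<open>y > 13/12 is exactly \<tau> > 5 y / 13, the positive curvature of circle 6; y <
    6/5 gives \<tau> < 1.\<close>
  have y: "y > 13 / 12" "y < 6 / 5" using x by (auto simp: y_def field_simps)
  have y2: "y\<^sup>2 > 1" "y\<^sup>2 < 2"
    using power_strict_mono[of "13 / 12" y 2] power_strict_mono[of y "6 / 5" 2] y by (auto simp: power2_eq_square)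
  have \<tau>2: "\<tau>\<^sup>2 = y\<^sup>2 - 1" using y2 by (simp add: \<tau>_def)
  have div1: "(1 - y\<^sup>2) / \<tau>\<^sup>2 = - 1" unfolding \<tau>2 using y2 by (simp add: field_simps)
  have \<tau>: "\<tau> > 0" "\<tau> < 1" using y2 by (auto simp: \<tau>_def)
  have g\<tau>: "g * \<tau> = 1 + y" using \<tau> by (simp add: g_def)
  have g: "g > 1" using \<tau> y by (simp add: g_def field_simps)
  have g_div: "g / \<tau> = 1 / (y - 1)"
  proof -
    have "g / \<tau> = (g * \<tau>) / \<tau>\<^sup>2" using \<tau> by (simp add: power2_eq_square)
    also have "\<dots> = (1 + y) / ((1 + y) * (y - 1))" unfolding g\<tau> \<tau>2 by (simp add: power2_eq_square algebra_simps)
    finally show ?thesis using y by simp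
  qed
  have cosh: "cos h = x / 2" unfolding h_def using x by simp
  have h0: "0 \<le> h" unfolding h_def using x by (intro arccos_lbound) auto
  \<comment> \<open>Keeps the largest angular difference 10 h at most 2 pi - 2 h, so the first and
    last chain circles do not overlap around the back. It follows from x \<ge> sqrt 3.\<close>
  have h6: "h \<le> pi / 6"
  proof -
    have "sqrt 3 \<le> x" using x by (intro real_le_lsqrt) (auto simp: power2_eq_square intro: order_trans[OF _ mult_mono[of "44/25" x "44/25" x]])
    then have "cos (pi / 6) \<le> cos h" by (simp add: cosh cos_30)
    moreover have "h \<le> pi" unfolding h_def using x by (intro arccos_ubound) auto
    ultimately show ?thesis using cos_mono_le_eq[of "pi / 6" h] h0 by simp
  qed
  \<comment> \<open>The quintic, as the condition that the chain ends at angles -5 h and 5 h touch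
    both caps.\<close>
  have cos5: "cos (5 * h) = 1 - x"
    unfolding cos_5 cosh using x(1) by (simp add: power_divide)
  have ycos: "y * cos h = 1" using xy by (simp add: cosh mult.commute)
  have ycos5: "y * cos (5 * h) = y - 2"
    unfolding cos5 using xy by (simp add: algebra_simps)
  have cos2: "y\<^sup>2 * cos (2 * h) = 2 - y\<^sup>2"
  proof -
    have "y\<^sup>2 * cos (2 * h) = 2 * (y * cos h)\<^sup>2 - y\<^sup>2"
      unfolding cos_double_cos by (simp add: power_mult_distrib right_diff_distrib)
    then show ?thesis by (simp add: ycos)
  qed
  have \<phi>_diff: "y\<^sup>2 * cos (\<phi> u - \<phi> v) \<le> 2 - y\<^sup>2" if "u < 6" "v < 6" "u \<noteq> v" for u v
  proof -
    have *: "cos (\<phi> u - \<phi> v) \<le> cos (2 * h)" if "v < u" "u < 6" for u v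
    proof -
      have eq: "\<phi> u - \<phi> v = (2 * (real u - real v)) * h" by (simp add: \<phi>_def algebra_simps)
      have "1 * (2 * h) \<le> (real u - real v) * (2 * h)" using that h0 by (intro mult_right_mono) auto
      moreover have "(real u - real v) * (2 * h) \<le> 5 * (2 * h)" using that h0 by (intro mult_right_mono) auto
      ultimately show ?thesis using h0 h6 unfolding eq by (intro cos_le_cos_double) (auto simp: mult_ac)
    qed
    have "cos (\<phi> u - \<phi> v) \<le> cos (2 * h)"
      using *[of u v] *[of v u] that by (metis cos_minus minus_diff_eq nat_neq_iff)
    then have "y\<^sup>2 * cos (\<phi> u - \<phi> v) \<le> y\<^sup>2 * cos (2 * h)" by (intro mult_left_mono) auto
    then show ?thesis by (simp only: cos2)
  qed
  have \<phi>_next: "y\<^sup>2 * cos (\<phi> u - \<phi> v) = 2 - y\<^sup>2" if "v = Suc u \<or> u = Suc v" for u v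
  proof -
    have "\<phi> u - \<phi> v = 2 * h \<or> \<phi> u - \<phi> v = - (2 * h)" using that by (auto simp: \<phi>_def algebra_simps)
    then show ?thesis using cos2 by (metis cos_minus)
  qed
  have \<phi>_abs: "cos (\<phi> k) = cos (\<bar>2 * real k - 5\<bar> * h)" for k
    by (auto simp: \<phi>_def abs_if) (metis cos_minus minus_diff_eq mult_minus_left)
  have \<phi>_le: "y * cos (\<phi> k) \<le> 1" if "k < 6" for k
  proof -
    have "\<bar>2 * real k - 5\<bar> \<ge> 1" "\<bar>2 * real k - 5\<bar> \<le> 5" using that by (auto simp: abs_if)
    then have "1 * h \<le> \<bar>2 * real k - 5\<bar> * h" "\<bar>2 * real k - 5\<bar> * h \<le> 5 * h"
      using h0 by (auto intro!: mult_right_mono simp del: mult_1)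
    then have "cos (\<phi> k) \<le> cos h" unfolding \<phi>_abs using h0 h6 by (intro cos_monotone_0_pi_le) auto
    then have "y * cos (\<phi> k) \<le> y * cos h" using y by (intro mult_left_mono) auto
    then show ?thesis by (simp only: ycos)
  qed
  have \<phi>_ge: "y * cos (\<phi> k) \<ge> y - 2" if "k < 6" for k
  proof -
    have "\<bar>2 * real k - 5\<bar> \<le> 5" using that by (auto simp: abs_if)
    then have "\<bar>2 * real k - 5\<bar> * h \<le> 5 * h" using h0 by (intro mult_right_mono)
    then have "cos (\<phi> k) \<ge> cos (5 * h)" unfolding \<phi>_abs using h0 h6 by (intro cos_monotone_0_pi_le) auto
    then have "y * cos (\<phi> k) \<ge> y * cos (5 * h)" using y by (intro mult_left_mono) auto
    then show ?thesis by (simp only: ycos5)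
  qed
  have \<phi>_end: "y * cos (\<phi> k) = y - 2" if "k = 0 \<or> k = 5" for k
  proof -
    have "\<bar>2 * real k - 5\<bar> = 5" using that by auto
    then have "cos (\<phi> k) = cos (5 * h)" unfolding \<phi>_abs by simp
    then show ?thesis by (simp only: ycos5)
  qed
  \<comment> \<open>Tangency to both poles forces m = 0 and t = 1/\<tau> for the chain circles, and
    norm 1 then forces the radius y/\<tau> in the (n, l) plane.\<close>
  define m where "m v = (if v = 6 then y else if v = 7 then - y else if v = 8 then 1 else if v = 9 then - 1 else 0)" for v :: nat
  define n where "n v = (if v < 6 then y / \<tau> * cos (\<phi> v) else if v < 8 then 0 else - g)" for v :: nat
  define l where "l v = (if v < 6 then y / \<tau> * sin (\<phi> v) else 0)" for v :: nat
  define t where "t v = (if v < 6 then 1 / \<tau> else if v < 8 then \<tau> else g)" for v :: nat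
  define q where "q u v = m u * m v + n u * n v + l u * l v - t u * t v" for u v
  have q_sym: "q u v = q v u" for u v by (simp add: q_def mult_ac)
  have q_ring: "q u v = (y\<^sup>2 * cos (\<phi> u - \<phi> v) - 1) / \<tau>\<^sup>2" if "u < 6" "v < 6" for u v
    using that \<tau> by (simp add: q_def m_def n_def l_def t_def cos_diff power2_eq_square field_simps)
  have q_cap: "q u v = - ((1 + y * cos (\<phi> u)) / (y - 1))" if "u < 6" "v = 8 \<or> v = 9" for u v
  proof -
    have "q u v = - ((g / \<tau>) * (1 + y * cos (\<phi> u)))"
      using that \<tau> by (auto simp: q_def m_def n_def l_def t_def field_simps)
    then show ?thesis by (simp add: g_div)
  qed
  have q_pole: "q u v = - 1" if "u < 6" "v = 6 \<or> v = 7" for u v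
    using that \<tau> by (auto simp: q_def m_def n_def l_def t_def)
  have q_rest: "q 6 7 = 1 - 2 * y\<^sup>2" "q 8 9 = - 1" "q 6 8 = - 1" "q 7 9 = - 1" "q 6 9 = - 1 - 2 * y" "q 7 8 = - 1 - 2 * y"
    using g\<tau> \<tau>2 by (auto simp: q_def m_def n_def l_def t_def power2_eq_square algebra_simps)
  have q_self: "q v v = 1" if v: "v < 10" for v
  proof -
    consider "v < 6" | "v = 6 \<or> v = 7" | "v = 8 \<or> v = 9" using v by linarith
    then show ?thesis
    proof cases
      case 1
      then show ?thesis using q_ring[of v v] y2 by (simp add: \<tau>2)
    next
      case 2
      then show ?thesis using \<tau>2 by (auto simp: q_def m_def n_def l_def t_def power2_eq_square)
    next
      case 3
      then show ?thesis by (auto simp: q_def m_def n_def l_def t_def)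
    qed
  qed
  have le: "q u v \<le> - 1" if uv: "u < v" "v < 10" for u v
  proof -
    have "v < 6 \<or> u < 6 \<and> (v = 6 \<or> v = 7) \<or> u < 6 \<and> (v = 8 \<or> v = 9)
      \<or> u = 6 \<and> v = 7 \<or> u = 6 \<and> v = 8 \<or> u = 6 \<and> v = 9 \<or> u = 7 \<and> v = 8 \<or> u = 7 \<and> v = 9 \<or> u = 8 \<and> v = 9"
      using uv by presburger
    then consider "v < 6" | "u < 6" "v = 6 \<or> v = 7" | "u < 6" "v = 8 \<or> v = 9"
      | "u = 6 \<and> v = 7 \<or> u = 6 \<and> v = 8 \<or> u = 6 \<and> v = 9 \<or> u = 7 \<and> v = 8 \<or> u = 7 \<and> v = 9 \<or> u = 8 \<and> v = 9"
      by blast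
    then show ?thesis
    proof cases
      case 1
      have "(y\<^sup>2 * cos (\<phi> u - \<phi> v) - 1) / \<tau>\<^sup>2 \<le> (2 - y\<^sup>2 - 1) / \<tau>\<^sup>2"
        using \<phi>_diff[of u v] 1 uv by (intro divide_right_mono) auto
      also have "\<dots> = - 1" using div1 by simp
      finally show ?thesis using q_ring[of u v] 1 uv by simp
    next
      case 2
      then show ?thesis using q_pole by simp
    next
      case 3
      have "(1 + y * cos (\<phi> u)) / (y - 1) \<ge> 1" using \<phi>_ge[of u] 3 y by (simp add: field_simps)
      then show ?thesis using q_cap[of u v] 3 by simp
    next
      case 4
      then show ?thesis using q_rest y y2 by auto
    qed
  qed
  have eq: "q u v = - 1" if "(u, v) \<in> set gadget_edges" for u v
  proof -
    have ring: "q u v = - 1" if "v = Suc u" "v < 6" for u v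
      using q_ring[of u v] \<phi>_next[of v u] that div1 by simp
    have pole: "q v u = - 1" if "u < 6" "v = 6 \<or> v = 7" for u v
      using q_pole[OF that] q_sym by simp
    have cap: "q v u = - 1" if "u = 0 \<or> u = 5" "v = 8 \<or> v = 9" for u v
      using q_cap[of u v] \<phi>_end[OF that(1)] that y by (auto simp: q_sym[of v])
    have "v = Suc u \<and> v < 6 \<or> v < 6 \<and> (u = 6 \<or> u = 7) \<or> (v = 0 \<or> v = 5) \<and> (u = 8 \<or> u = 9)
        \<or> (u, v) = (8, 9) \<or> (u, v) = (8, 6) \<or> (u, v) = (9, 7)"
      using that unfolding gadget_edges_def list.set insert_iff empty_iff by (elim disjE) simp_all
    then show ?thesis
    proof (elim disjE conjE)
      assume "(u, v) = (8, 6)"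
      then show ?thesis using q_rest(3) q_sym[of 8 6] by simp
    next
      assume "(u, v) = (9, 7)"
      then show ?thesis using q_rest(4) q_sym[of 9 7] by simp
    qed (use ring pole cap q_rest(2) in simp_all)
  qed
  \<comment> \<open>Rotate the (m, n) plane so that (5, 12)/13 is an axis: A and C are t minus and
    plus that coordinate, B is the orthogonal one.\<close>
  define A where "A v = t v - (5 * m v + 12 * n v) / 13" for v
  define B where "B v = (12 * m v - 5 * n v) / 13" for v
  define C where "C v = t v + (5 * m v + 12 * n v) / 13" for v
  have prod: "B u * B v + l u * l v - (A u * C v + A v * C u) / 2 = q u v" for u v
    by (simp add: A_def B_def C_def q_def field_simps)
  have norm: "(B v)\<^sup>2 + (l v)\<^sup>2 = 1 + A v * C v" if "v < 10" for v
    using prod[of v v] q_self[OF that] by (simp add: power2_eq_square)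
  have A: "A v > 0" if v: "v < 10" for v
  proof -
    consider "v < 6" | "v = 6" | "v = 7" | "v = 8 \<or> v = 9" using v by linarith
    then show ?thesis
    proof cases
      case 1
      have "A v = (1 - 12 / 13 * (y * cos (\<phi> v))) / \<tau>" using 1 by (simp add: A_def m_def n_def t_def diff_divide_distrib)
      moreover have "1 - 12 / 13 * (y * cos (\<phi> v)) > 0" using \<phi>_le[OF 1] by simp
      ultimately show ?thesis using \<tau> by simp
    next
      case 2
      have "(5 / 13 * y)\<^sup>2 < \<tau>\<^sup>2"
        using power_strict_mono[of "13 / 12" y 2] y unfolding \<tau>2 by (simp add: power2_eq_square)
      then have "5 / 13 * y < \<tau>" by (rule power2_less_imp_less) (use \<tau> in simp)
      then show ?thesis using 2 by (simp add: A_def m_def n_def t_def)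
    next
      case 3
      then show ?thesis using \<tau> y by (simp add: A_def m_def n_def t_def)
    next
      case 4
      then show ?thesis using g by (auto simp: A_def m_def n_def t_def)
    qed
  qed
  define c where "c v = Complex (B v / A v) (l v / A v)" for v
  define r where "r v = 1 / A v" for v
  have dist: "(cmod (c u - c v))\<^sup>2 = (r u + r v)\<^sup>2 + 2 * (- 1 - q u v) / (A u * A v)" if "u < 10" "v < 10" for u v
    using lorentz_circle_distance[OF A A norm norm, OF that(1) that(2) that(1) that(2)]
    unfolding c_def r_def prod .
  have "circle_packing 10 gadget c r"
    unfolding circle_packing_def
  proof (intro conjI allI impI)
    show r0: "r v > 0" if "v < 10" for v using A[OF that] by (simp add: r_def)
    fix u v :: nat assume uv: "u < 10" "v < 10"
    show "cmod (c u - c v) \<ge> r u + r v" if "u \<noteq> v"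
    proof -
      have "q u v \<le> - 1" using le[of u v] le[of v u] q_sym[of u v] that uv by (metis nat_neq_iff)
      then have "2 * (- 1 - q u v) / (A u * A v) \<ge> 0"
        using A uv by (intro divide_nonneg_pos) auto
      then have "(r u + r v)\<^sup>2 \<le> (cmod (c u - c v))\<^sup>2" using dist uv by simp
      then show ?thesis by (rule power2_le_imp_le) simp
    qed
    show "cmod (c u - c v) = r u + r v" if "gadget u v"
    proof -
      have "q u v = - 1" using that eq[of u v] eq[of v u] q_sym[of u v] by (auto simp: gadget_def)
      then have "(cmod (c u - c v))\<^sup>2 = (r u + r v)\<^sup>2" using dist uv by simp
      then show ?thesis using r0 uv by (simp add: power2_eq_iff_nonneg add_nonneg_nonneg less_imp_le)
    qed
  qed
  then show ?thesis by blast
qed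

text \<open>All earlier circles lie in the disc of radius M about 0, so a unit circle centred at M +
  1 stays clear of them.\<close>

lemma circle_packing_add_isolated:
  assumes pack: "circle_packing n E c r" and E: "\<And>u v. E u v \<Longrightarrow> u < n \<and> v < n"
  shows "\<exists>c r. circle_packing (n + k) E c r"
proof (induction k)
  case 0
  then show ?case using pack by auto
next
  case (Suc k)
  then obtain c r where p: "circle_packing (n + k) E c r" by blast
  define M where "M = (\<Sum>v<n + k. cmod (c v) + r v)"
  have r: "r v > 0" if "v < n + k" for v using p that by (simp add: circle_packing_def)
  have M: "cmod (c v) + r v \<le> M" if "v < n + k" for v
    unfolding M_def using that r by (intro member_le_sum) (auto intro!: add_nonneg_nonneg intro: less_imp_le)
  have far: "r v + 1 \<le> cmod (c v - of_real (M + 1))" if "v < n + k" for v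
  proof -
    have "M + 1 \<le> cmod (of_real (M + 1))" by simp
    also have "\<dots> \<le> cmod (c v) + cmod (c v - of_real (M + 1))"
      using norm_triangle_ineq4[of "c v" "c v - of_real (M + 1)"] by simp
    finally show ?thesis using M[OF that] by simp
  qed
  have "circle_packing (n + Suc k) E (c(n + k := of_real (M + 1))) (r(n + k := 1))"
    unfolding circle_packing_def
  proof (intro conjI allI impI)
    fix u v assume uv: "u < n + Suc k" "v < n + Suc k"
    show "(r(n + k := 1)) v > 0" using uv r by auto
    show "cmod ((c(n + k := of_real (M + 1))) u - (c(n + k := of_real (M + 1))) v)
      \<ge> (r(n + k := 1)) u + (r(n + k := 1)) v" if ne: "u \<noteq> v"
    proof -
      consider "u < n + k" "v < n + k" | "u = n + k" "v < n + k" | "v = n + k" "u < n + k"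
        using uv ne by linarith
      then show ?thesis
      proof cases
        case 1
        then show ?thesis using p ne by (simp add: circle_packing_def)
      next
        case 2
        then show ?thesis using far[of v] norm_minus_commute[of "c v"] by simp
      next
        case 3
        then show ?thesis using far[of u] by simp
      qed
    qed
    show "cmod ((c(n + k := of_real (M + 1))) u - (c(n + k := of_real (M + 1))) v)
      = (r(n + k := 1)) u + (r(n + k := 1)) v" if "E u v"
      using E[OF that] p that by (simp add: circle_packing_def)
  qed
  then show ?case by blast
qed

section \<open>Radical computation trees\<close>

lemma rop_step_radical:
  assumes "rop_step vs p x" "set vs \<subseteq> radical_numbers"
  shows "x \<in> radical_numbers"
  using assms
proof cases
  case (6 i k)
  then have "vs ! i \<in> radical_numbers" using assms(2) by auto
  then show ?thesis using 6 radical_numbers.root[of "vs ! i" k x] by simp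
next
  case (7 i)
  then have "vs ! i \<in> radical_numbers" using assms(2) by auto
  then show ?thesis using 7 radical_numbers_cnj by simp
qed (use assms(2) nth_mem in \<open>blast intro: radical_numbers.intros(1-5)\<close>)+

text \<open>A decision only selects the subtree that is run, so closure under the computation steps
  suffices.\<close>

lemma rtree_run_radical:
  assumes "rtree_run t vs out" "set vs \<subseteq> radical_numbers"
  shows "set out \<subseteq> radical_numbers"
  using assms
proof induction
  case (comp vs p x t out)
  then show ?case using rop_step_radical[OF comp(1)] by simp
qed auto

text \<open>Only the squared modulus z * cnj z enters. Positivity ensures that \<open>sqrt\<close>
  has a positive argument and squares back to it.\<close>

lemma half_chord_radical:
  assumes c: "c i \<in> radical_numbers" "c j \<in> radical_numbers"
    and r: "of_real (r i) \<in> radical_numbers" "of_real (r j) \<in> radical_numbers"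
    and ge: "half_chord c r i j > 0"
  shows "complex_of_real (half_chord c r i j) \<in> radical_numbers"
proof -
  have sq: "complex_of_real (cmod z) * complex_of_real (cmod z) = z * cnj z" for z
    using complex_norm_square[of z] by (simp only: power2_eq_square of_real_mult)
  have "complex_of_real (half_chord c r i j) ^ 2 = of_real ((half_chord c r i j)\<^sup>2)" by simp
  also have "(half_chord c r i j)\<^sup>2 = ((cmod (c i - c j))\<^sup>2 - (r i - r j)\<^sup>2) / (4 * r i * r j)"
    using ge unfolding half_chord_def by (simp only: real_sqrt_gt_0_iff real_sqrt_pow2 less_imp_le)
  also have "complex_of_real \<dots> = ((c i - c j) * cnj (c i - c j)
      - (of_real (r i) - of_real (r j)) * (of_real (r i) - of_real (r j))) / (4 * of_real (r i) * of_real (r j))"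
    by (simp only: of_real_divide of_real_diff of_real_mult of_real_numeral power2_eq_square
        sq)
  also have "\<dots> \<in> radical_numbers"
    using radical_numbers.of_int[of 4] c r
    by (intro radical_numbers.divide radical_numbers.diff radical_numbers.mult radical_numbers_cnj) auto
  finally show ?thesis using radical_numbers.root[of _ 2] by simp
qed

lemma simple_graph_gadget: "n \<ge> 10 \<Longrightarrow> simple_graph n gadget"
  unfolding simple_graph_def gadget_def gadget_edges_def by auto

theorem theorem12:
  shows "\<exists>E. simple_graph 16 E \<and> (\<exists>c r. circle_packing 16 E c r) \<and>
           (\<forall>t. \<not> constructs_packing 16 E t)"
proof (intro exI[of _ gadget] conjI allI notI)
  show "simple_graph 16 gadget" by (rule simple_graph_gadget) simp
  \<comment> \<open>The quintic changes sign on this interval, which lies above sqrt 3 and keeps 2 /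
    x above 13/12.\<close>
  obtain x :: real where x: "44 / 25 \<le> x" "x \<le> 177 / 100" "x ^ 5 - 5 * x ^ 3 + 7 * x - 2 = 0"
    using quintic_real_root_between[of "44 / 25" "177 / 100"] by (auto simp: eval_nat_numeral)
  obtain c r where "circle_packing 10 gadget c r" using gadget_packing_exists[OF x(3,1,2)] by blast
  then show "\<exists>c r. circle_packing 16 gadget c r"
    using circle_packing_add_isolated[of 10 gadget c r 6] simple_graph_gadget[of 10]
    by (simp add: simple_graph_def)
next
  fix t assume "constructs_packing 16 gadget t"
  then obtain out where out: "rtree_run t [] out" "length out = 32" "\<And>v. v < 16 \<Longrightarrow> Im (out ! (16 + v)) = 0"
    and pack: "circle_packing 16 gadget (\<lambda>v. out ! v) (\<lambda>v. Re (out ! (16 + v)))"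
    unfolding constructs_packing_def by auto
  define c where "c v = out ! v" for v
  define r where "r v = Re (out ! (16 + v))" for v
  have rad: "out ! i \<in> radical_numbers" if "i < 32" for i
    using rtree_run_radical[OF out(1)] that out(2) by (metis empty_subsetI list.set(1) nth_mem subsetD)
  have r_rad: "complex_of_real (r v) \<in> radical_numbers" if "v < 16" for v
  proof -
    have "complex_of_real (r v) = out ! (16 + v)" using out(3)[OF that] by (simp add: r_def complex_eq_iff)
    then show ?thesis using rad that by simp
  qed
  have pack: "circle_packing 16 gadget c r" using pack by (simp add: c_def[abs_def] r_def[abs_def])
  define x where "x = half_chord c r 0 2"
  have "x \<ge> 1" using pack unfolding x_def by (intro half_chord_ge_1) (auto simp: circle_packing_def)
  then have "complex_of_real x \<in> radical_numbers"
    unfolding x_def by (intro half_chord_radical) (auto simp: c_def intro: rad r_rad)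
  moreover have "x ^ 5 - 5 * x ^ 3 + 7 * x - 2 = 0"
    using gadget_quintic[OF pack] by (simp add: x_def)
  then have "complex_of_real (x ^ 5 - 5 * x ^ 3 + 7 * x - 2) = 0" by simp
  then have "poly quintic (of_real x) = 0" by (simp add: poly_quintic)
  ultimately show False using quintic_root_not_radical by blast
qed

end
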